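(* Let $1<p<\infty$ and $0<\gamma<1$. All analytic subsets of $X$, and hence all Borel subsets of $X$, are $\mathcal{C}_{\gamma,p}$-capacitable; that is, for every analytic set $E\subset X$, $$\mathcal{C}_{\gamma,p}(E)=\sup\{\mathcal{C}_{\gamma,p}(K):K\subset E,\ K\text{ compact}\}=\inf\{\mathcal{C}_{\gamma,p}(O):O\supset E,\ O\text{ open}\}.$$
   Context: Setting: $X=(X,d,\mu)$ is a locally compact metric space equipped with a Borel regular outer measure $\mu$ that is doubling, i.e. there is a constant $c_d\ge 1$ with $\mu(B(x,2r))\le c_d\,\mu(B(x,r))$ for every ball $B(x,r)=\{y\in X: d(y,x)<r\}$. Every open ball has positive and finite measure. Spheres have measure zero, $\mu(\{y\in X: d(x,y)=r\})=0$ for all $x\in X$, $r>0$, and points have measure zero, $\mu(\{x\})=0$ for all $x\in X$. For $0<\gamma<1$, the Riesz potential of order $\gamma$ of a measurable function $f$ is $$I_\gamma f(x)=\int_X \frac{f(y)}{\mu(B(x,d(x,y)))^{1-\gamma}}\,d\mu(y)$$ (the single point $y=x$ may be omitted from the domain of integration, since it is $\mu$-null). $L^p_+(X)$ denotes the set of non-negative functions in $L^p(X)=L^p(X,\mu)$. For $1<p<\infty$ and any $E\subset X$, the Riesz $(\gamma,p)$-capacity is $\mathcal{C}_{\gamma,p}(E)=\inf_{f\in\mathcal{A}(E)}\|f\|_{L^p(X)}^p$, where $\mathcal{A}(E)=\{f\in L^p_+(X): I_\gamma f\ge 1\text{ on }E\}$ and $\mathcal{C}_{\gamma,p}(E)=\infty$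 if $\mathcal{A}(E)=\emptyset$. Analytic sets are understood in the standard (Suslin) sense: $E\subset X$ is analytic if it is empty or a continuous image of a Polish space. *)

theory Defs
  imports "HOL-Analysis.Analysis"
begin

section \<open>Metric spaces with a Borel regular doubling outer measure\<close>

text \<open>
  The set function \<open>\<mu>\<close> is an outer measure on all subsets of the space.  Integrals are taken with
  respect to its restriction to the Caratheodory measurable sets.
\<close>

definition caratheodory_measure :: "('a set \<Rightarrow> ennreal) \<Rightarrow> 'a measure" where
  "caratheodory_measure \<mu> = measure_of UNIV (lambda_system UNIV (Pow UNIV) \<mu>) \<mu>"

text \<open>
  \<open>measure_of\<close> returns the null measure on a non-measure; for an outer measure this does not happen:
\<close>

lemma
  assumes "outer_measure_space (Pow UNIV) \<mu>"
  shows sets_caratheodory_measure: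
      "sets (caratheodory_measure \<mu>) = lambda_system UNIV (Pow UNIV) \<mu>"
    and space_caratheodory_measure: "space (caratheodory_measure \<mu>) = UNIV"
    and emeasure_caratheodory_measure:
      "A \<in> lambda_system UNIV (Pow UNIV) \<mu> \<Longrightarrow> emeasure (caratheodory_measure \<mu>) A = \<mu> A"
proof -
  have ms: "measure_space UNIV (lambda_system UNIV (Pow UNIV) \<mu>) \<mu>"
    using sigma_algebra.caratheodory_lemma[OF sigma_algebra_Pow assms] .
  then have sa: "sigma_algebra UNIV (lambda_system UNIV (Pow UNIV) \<mu>)"
    by (simp add: measure_space_def)
  show s: "sets (caratheodory_measure \<mu>) = lambda_system UNIV (Pow UNIV) \<mu>"
    unfolding caratheodory_measure_def by (rule sigma_algebra.sets_measure_of_eq[OF sa])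
  show "space (caratheodory_measure \<mu>) = UNIV"
    by (simp add: caratheodory_measure_def space_measure_of_conv)
  show "A \<in> lambda_system UNIV (Pow UNIV) \<mu> \<Longrightarrow> emeasure (caratheodory_measure \<mu>) A = \<mu> A"
    using ms by (intro emeasure_measure_of[OF caratheodory_measure_def])
      (auto simp: measure_space_def s)
qed

definition borel_regular :: "('a::topological_space set \<Rightarrow> ennreal) \<Rightarrow> bool" where
  "borel_regular \<mu> \<longleftrightarrow>
     sets borel \<subseteq> lambda_system UNIV (Pow UNIV) \<mu> \<and>
     (\<forall>A. \<exists>B\<in>sets borel. A \<subseteq> B \<and> \<mu> B = \<mu> A)"

definition doubling :: "('a::metric_space set \<Rightarrow> ennreal) \<Rightarrow> bool" where
  "doubling \<mu> \<longleftrightarrow>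
     (\<exists>c\<ge>1. \<forall>x. \<forall>r>0. \<mu> (ball x (2 * r)) \<le> ennreal c * \<mu> (ball x r))"

section \<open>Riesz potentials and capacities\<close>

text \<open>
  The potential is only used for non-negative \<open>f\<close> and may be infinite, hence it is a
  non-negative Lebesgue integral.  The point \<open>y = x\<close>, where \<open>ball x 0 = {}\<close> makes the denominator
  vanish, is omitted from the domain of integration.  Balls have finite measure in our setting,
  so nothing is lost by \<open>enn2real\<close>.
\<close>

definition riesz_potential ::
    "('a::metric_space set \<Rightarrow> ennreal) \<Rightarrow> real \<Rightarrow> ('a \<Rightarrow> real) \<Rightarrow> 'a \<Rightarrow> ennreal" where
  "riesz_potential \<mu> \<gamma> f x =
     (\<integral>\<^sup>+y\<in>- {x}. ennreal (f y / enn2real (\<mu> (ball x (dist x y))) powr (1 - \<gamma>))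
        \<partial>caratheodory_measure \<mu>)"

text \<open>Elements of \<open>L\<^sup>p\<close> are represented by everywhere finite, everywhere non-negative functions.\<close>

definition Lp_plus :: "('a set \<Rightarrow> ennreal) \<Rightarrow> real \<Rightarrow> ('a \<Rightarrow> real) set" where
  "Lp_plus \<mu> p =
     {f \<in> borel_measurable (caratheodory_measure \<mu>).
        (\<forall>x. 0 \<le> f x) \<and> integrable (caratheodory_measure \<mu>) (\<lambda>x. \<bar>f x\<bar> powr p)}"

definition Lp_norm :: "('a set \<Rightarrow> ennreal) \<Rightarrow> real \<Rightarrow> ('a \<Rightarrow> real) \<Rightarrow> real" where
  "Lp_norm \<mu> p f = (\<integral>x. \<bar>f x\<bar> powr p \<partial>caratheodory_measure \<mu>) powr (1 / p)"

definition riesz_admissible ::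
    "('a::metric_space set \<Rightarrow> ennreal) \<Rightarrow> real \<Rightarrow> real \<Rightarrow> 'a set \<Rightarrow> ('a \<Rightarrow> real) set" where
  "riesz_admissible \<mu> \<gamma> p E = {f \<in> Lp_plus \<mu> p. \<forall>x\<in>E. riesz_potential \<mu> \<gamma> f x \<ge> 1}"

text \<open>The infimum is taken in \<open>[0, \<infinity>]\<close>, so it is \<open>\<infinity>\<close> if there is no admissible function.\<close>

definition riesz_capacity ::
    "('a::metric_space set \<Rightarrow> ennreal) \<Rightarrow> real \<Rightarrow> real \<Rightarrow> 'a set \<Rightarrow> ennreal" where
  "riesz_capacity \<mu> \<gamma> p E = (INF f\<in>riesz_admissible \<mu> \<gamma> p E. ennreal (Lp_norm \<mu> p f powr p))"

definition capacitable :: "('a::topological_space set \<Rightarrow> ennreal) \<Rightarrow> 'a set \<Rightarrow> bool" where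
  "capacitable C E \<longleftrightarrow>
     C E = (SUP K\<in>{K. K \<subseteq> E \<and> compact K}. C K) \<and>
     C E = (INF U\<in>{U. E \<subseteq> U \<and> open U}. C U)"

section \<open>Analytic sets\<close>

definition polish_topology :: "'b topology \<Rightarrow> bool" where
  "polish_topology Y \<longleftrightarrow> completely_metrizable_space Y \<and> separable_space Y"

text \<open>
  A definition cannot quantify existentially over types, so the type \<open>'b\<close> on a subset of which the
  Polish space lives is a parameter.  A theorem assuming \<open>analytic_set TYPE('b) E\<close> for
  a type variable \<open>'b\<close> covers the continuous images of all Polish spaces.
\<close>

definition analytic_set :: "'b itself \<Rightarrow> 'a::topological_space set \<Rightarrow> bool" where
  "analytic_set _ E \<longleftrightarrow>
     E = {} \<or>
     (\<exists>(Y :: 'b topology) g. polish_topology Y \<and> continuous_map Y euclidean g \<and> E = g ` topspace Y)"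

end

theory Submission
  imports Defs
begin

text \<open>
  The proof is Choquet's capacitability argument.  It rests on three properties of the capacity \<open>C\<close>:
  monotonicity, outer regularity, and \<open>C (E n) \<rightarrow> C (\<Union>n. E n)\<close> for increasing sequences of arbitrary
  sets.

  Outer regularity (\<open>cap_outer_regular\<close>) holds because potentials of non-negative functions are lower
  semicontinuous (\<open>open_pot_greater\<close>).  That follows from Fatou's lemma, as the measure of
  \<open>ball x (dist x y)\<close> is upper semicontinuous in \<open>x\<close> when spheres are null sets.

  Continuity along increasing sequences (\<open>cap_incseq\<close>) uses that \<open>L\<^sup>p\<close> is uniformly convex for \<open>p > 1\<close>:
  near minimisers \<open>f n\<close> for \<open>E n\<close> form a Cauchy sequence, since the mean of \<open>f n\<close> and \<open>f m\<close> is again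
  admissible for the smaller set (\<open>near_minimisers_Cauchy\<close>).  A rapidly converging subsequence
  \<open>g 0, g 1, \<dots>\<close> is dominated by \<open>g 0 + (\<Sum>i. \<bar>g (Suc i) - g i\<bar>)\<close>, which is admissible for the union and
  costs hardly more than \<open>g 0\<close> (\<open>dominating_function\<close>).

  For the image \<open>E\<close> of a Polish space, these properties give compact subsets of nearly full capacity
  (\<open>capacity_compact_approximation\<close>): cut the Polish space down to a totally bounded part by
  selecting, for one radius after the other, finitely many balls whose union still carries most of the
  capacity.

  Borel sets are treated by the same argument, applied to the identity map.  The
  space is sigma-compact (\<open>locally_compact_sigma_compact\<close>): the measure makes it separable, and it is
  locally compact.  The existence of suitable covers is then inherited from closed and open sets by all
  Borel sets (\<open>compactly_resolvable_borel\<close>).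
\<close>

section \<open>Uniform convexity of powers\<close>

text \<open>
  Strict Bernoulli inequality: the graph of \<open>u powr p\<close> touches its tangent at \<open>1\<close> only there.
  Both the uniform convexity and the weighted power mean inequality below come from it.
\<close>

lemma powr_tangent_strict:
  fixes p u :: real
  assumes "1 < p" "0 \<le> u" "u \<noteq> 1"
  shows "1 + p * (u - 1) < u powr p"
proof (cases "u = 0")
  case True
  then show ?thesis using assms by simp
next
  case False
  then have u: "0 < u" using assms by simp
  define F where "F v = v powr p - p * v" for v :: real
  have der: "(F has_real_derivative p * (v powr (p - 1) - 1)) (at v)" if "0 < v" for v
    unfolding F_def using that
    by (auto intro!: derivative_eq_intros simp: algebra_simps)
  show ?thesis
  proof (cases "1 < u")
    case True
    have "F 1 < F u"
    proof (rule DERIV_pos_imp_increasing_open[OF True])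
      show "\<exists>y. (F has_real_derivative y) (at v) \<and> 0 < y" if "1 < v" "v < u" for v
        using der[of v] that assms by (intro exI conjI) auto
      show "continuous_on {1..u} F"
        unfolding F_def by (intro continuous_intros) auto
    qed
    then show ?thesis by (simp add: F_def algebra_simps)
  next
    case False
    then have u1: "u < 1" using assms by simp
    have "F u > F 1"
    proof (rule DERIV_neg_imp_decreasing_open[OF u1])
      show "\<exists>y. (F has_real_derivative y) (at v) \<and> y < 0" if "u < v" "v < 1" for v
        using der[of v] that assms u powr_less_mono2[of "p - 1" v 1]
        by (intro exI conjI) (auto intro!: mult_pos_neg)
      show "continuous_on {u..1} F"
        unfolding F_def using u by (intro continuous_intros) auto
    qed
    then show ?thesis by (simp add: F_def algebra_simps)
  qed
qed

text \<open>
  A qualitative substitute for Clarkson's inequalities that treats all \<open>p > 1\<close> alike.  Both sides are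
  homogeneous of degree \<open>p\<close>, so it suffices to look at \<open>a = t\<close>, \<open>b = 1 - t\<close>.  There the convexity
  defect \<open>\<phi>\<close> is continuous and vanishes only at \<open>t = 1/2\<close>, where the left-hand side is smaller than
  the \<open>e\<close>-term; on the compact set where the \<open>e\<close>-term does not suffice, \<open>\<phi>\<close> is bounded below by
  some \<open>d > 0\<close>, and \<open>M = 1/d\<close> works.
\<close>

lemma powr_uniformly_convex:
  fixes p e :: real
  assumes p: "1 < p" and e: "0 < e"
  obtains M where "0 \<le> M"
    "\<And>a b. 0 \<le> a \<Longrightarrow> 0 \<le> b \<Longrightarrow>
       \<bar>a - b\<bar> powr p \<le> e * (a powr p + b powr p)
          + M * ((a powr p + b powr p) / 2 - ((a + b) / 2) powr p)"
proof -
  define \<phi> where "\<phi> t = (t powr p + (1 - t) powr p) / 2 - (1 / 2) powr p" for t :: real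
  define \<psi> where "\<psi> t = \<bar>2 * t - 1\<bar> powr p - e * (t powr p + (1 - t) powr p)" for t :: real
  have c\<phi>: "continuous_on {0..1} \<phi>" and c\<psi>: "continuous_on {0..1} \<psi>"
    unfolding \<phi>_def \<psi>_def using p by (auto intro!: continuous_intros continuous_on_powr')
  have \<phi>_pos: "0 < \<phi> t" if t: "t \<in> {0..1}" "t \<noteq> 1 / 2" for t
  proof -
    have "2 < (2 * t) powr p + (2 * (1 - t)) powr p"
      using powr_tangent_strict[OF p, of "2 * t"] powr_tangent_strict[OF p, of "2 * (1 - t)"] t
      by (auto simp: algebra_simps)
    also have "\<dots> = 2 powr p * (t powr p + (1 - t) powr p)"
      using t by (simp add: powr_mult distrib_left del: right_diff_distrib_numeral)
    finally show ?thesis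
      unfolding \<phi>_def by (simp add: powr_divide field_simps)
  qed
  \<comment> \<open>Outside \<open>S\<close> the \<open>e\<close>-term alone dominates.\<close>
  define S where "S = {t \<in> {0..1}. 0 \<le> \<psi> t}"
  have "closed S"
    unfolding S_def by (intro continuous_on_closed_Collect_le c\<psi>) auto
  then have "compact S"
    using compact_Int_closed[of "{0..1}" S] by (simp add: S_def Int_def conj_ac)
  have S_pos: "0 < \<phi> t" if "t \<in> S" for t
  proof -
    have "\<psi> (1 / 2) < 0"
      unfolding \<psi>_def using e by simp
    then show ?thesis
      using that \<phi>_pos[of t] by (cases "t = 1 / 2") (auto simp: S_def)
  qed
  obtain d where d: "0 < d" "\<And>t. t \<in> S \<Longrightarrow> d \<le> \<phi> t"
  proof (cases "S = {}")
    case True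
    then show ?thesis using that[of 1] by simp
  next
    case False
    have "continuous_on S \<phi>"
      by (rule continuous_on_subset[OF c\<phi>]) (auto simp: S_def)
    then obtain s where "s \<in> S" "\<And>t. t \<in> S \<Longrightarrow> \<phi> s \<le> \<phi> t"
      using continuous_attains_inf[OF \<open>compact S\<close> False] by blast
    then show ?thesis using that[of "\<phi> s"] S_pos by blast
  qed
  have key: "\<psi> t \<le> 1 / d * \<phi> t" if t: "t \<in> {0..1}" for t
  proof (cases "t \<in> S")
    case True
    have "\<psi> t \<le> \<bar>2 * t - 1\<bar> powr p"
      unfolding \<psi>_def using e by simp
    also have "\<dots> \<le> 1"
      using t p by (intro powr_le1) auto
    also have "1 \<le> 1 / d * \<phi> t"
      using d True by (simp add: field_simps)
    finally show ?thesis .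
  next
    case False
    moreover have "0 \<le> \<phi> t"
    proof (cases "t = 1 / 2")
      case True
      show ?thesis unfolding True by (simp add: \<phi>_def)
    qed (use \<phi>_pos[of t] t in simp)
    moreover have "0 \<le> 1 / d * \<phi> t"
      using d \<open>0 \<le> \<phi> t\<close> by simp
    ultimately show ?thesis
      using t by (auto simp: S_def)
  qed
  show ?thesis
  proof (rule that[of "1 / d"])
    show "0 \<le> 1 / d" using d by simp
    show "\<bar>a - b\<bar> powr p \<le> e * (a powr p + b powr p)
          + 1 / d * ((a powr p + b powr p) / 2 - ((a + b) / 2) powr p)" (is "?l \<le> ?r")
      if ab: "0 \<le> a" "0 \<le> b" for a b
    proof (cases "a + b = 0")
      case True
      then have "a = 0" "b = 0" using ab by auto
      then show ?thesis by simp
    next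
      case False
      define s where "s = a + b"
      define t where "t = a / s"
      have s: "0 < s" using ab False by (simp add: s_def)
      have t: "t \<in> {0..1}" using ab s by (auto simp: t_def s_def)
      have eqs: "a = s * t" "b = s * (1 - t)" "a + b = s"
        using s by (auto simp: t_def s_def field_simps)
      have "\<bar>a - b\<bar> = s * \<bar>2 * t - 1\<bar>"
        using s abs_mult[of s "2 * t - 1"] unfolding eqs by (simp add: algebra_simps)
      then have "?l = s powr p * \<bar>2 * t - 1\<bar> powr p"
        using s by (simp add: powr_mult)
      also have "\<dots> = s powr p * (\<psi> t + e * (t powr p + (1 - t) powr p))"
        by (simp add: \<psi>_def)
      also have "\<dots> \<le> s powr p * (1 / d * \<phi> t + e * (t powr p + (1 - t) powr p))"
        using key[OF t] by (intro mult_left_mono) auto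
      also have "\<dots> = e * ((s * t) powr p + (s * (1 - t)) powr p) +
          1 / d * (((s * t) powr p + (s * (1 - t)) powr p) / 2 - (s * (1 / 2)) powr p)"
        unfolding \<phi>_def powr_mult by (simp add: field_simps del: right_diff_distrib)
      also have "\<dots> = ?r"
        using eqs by simp
      finally show ?thesis .
    qed
  qed
qed

text \<open>
  Jensen's inequality for \<open>u powr p\<close> at the points \<open>a i / w i\<close>, in a form that allows total weight less
  than \<open>1\<close>.  It replaces Minkowski's inequality for infinite sums: it bounds the \<open>p\<close>-th power of a
  partial sum by a series that can be integrated term by term.
\<close>

lemma powr_sum_le_weighted:
  fixes p :: real and a w :: "'i \<Rightarrow> real"
  assumes p: "1 < p"
    and a: "\<And>i. i \<in> I \<Longrightarrow> 0 \<le> a i"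
    and w: "\<And>i. i \<in> I \<Longrightarrow> 0 < w i" "(\<Sum>i\<in>I. w i) \<le> 1"
  shows "(\<Sum>i\<in>I. a i) powr p \<le> (\<Sum>i\<in>I. w i powr (1 - p) * a i powr p)"
proof (cases "(\<Sum>i\<in>I. a i) = 0")
  case True
  then show ?thesis by (auto intro!: sum_nonneg)
next
  case False
  define s where "s = (\<Sum>i\<in>I. a i)"
  have s: "0 < s"
    using False sum_nonneg[of I a] a by (simp add: s_def less_le)
  have "1 \<le> (\<Sum>i\<in>I. w i) * (1 - p) + p"
    using mult_right_mono[OF w(2), of "p - 1"] p by (simp add: algebra_simps)
  also have "\<dots> = (\<Sum>i\<in>I. w i * (1 - p)) + p * (\<Sum>i\<in>I. a i / s)"
    using s by (simp add: sum_distrib_right s_def flip: sum_divide_distrib)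
  also have "\<dots> = (\<Sum>i\<in>I. w i * (1 + p * (a i / (w i * s) - 1)))"
    unfolding sum_distrib_left sum.distrib[symmetric]
    using w(1) s by (intro sum.cong refl) (simp add: field_simps less_imp_neq[symmetric])
  also have "\<dots> \<le> (\<Sum>i\<in>I. w i * (a i / (w i * s)) powr p)"
  proof (intro sum_mono mult_left_mono)
    fix i assume i: "i \<in> I"
    show "1 + p * (a i / (w i * s) - 1) \<le> (a i / (w i * s)) powr p"
      using powr_tangent_strict[OF p, of "a i / (w i * s)"] a[OF i] w(1)[OF i] s
      by (cases "a i / (w i * s) = 1") auto
    show "0 \<le> w i" using w(1)[OF i] by simp
  qed
  also have "\<dots> = (\<Sum>i\<in>I. w i powr (1 - p) * a i powr p) / s powr p"
    unfolding sum_divide_distrib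
  proof (intro sum.cong refl)
    fix i assume i: "i \<in> I"
    then show "w i * (a i / (w i * s)) powr p = w i powr (1 - p) * a i powr p / s powr p"
      using w(1)[OF i] s a[OF i] by (simp add: powr_divide powr_mult powr_diff)
  qed
  finally show ?thesis
    using s by (simp add: s_def[symmetric] field_simps)
qed

section \<open>Choquet's argument and Polish spaces\<close>

text \<open>
  Choquet's argument.  Think of \<open>Y\<close> as a Polish space and of \<open>A i j\<close> as the union of the first \<open>j\<close> balls
  of a countable cover by balls of radius \<open>1/(i+1)\<close>.  Continuity along increasing sequences allows to
  choose \<open>m 0\<close>, \<open>m 1\<close>, \<dots> such that the images of \<open>T n = Y \<inter> A 0 (m 0) \<inter> \<dots> \<inter> A (n - 1) (m (n - 1))\<close>
  all have capacity greater than \<open>t\<close>.  The last hypothesis on \<open>A\<close> is the sequential compactness that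
  makes the intersection \<open>K\<close> of the closures of these images a compact subset of \<open>g ` Y\<close> and forces
  every open \<open>U \<supseteq> K\<close> to contain one of the images.  Hence \<open>C U > t\<close> for all such \<open>U\<close>, and outer
  regularity gives \<open>t \<le> C K\<close>.
\<close>

lemma capacity_compact_approximation:
  fixes C :: "'a::metric_space set \<Rightarrow> ennreal" and g :: "'b \<Rightarrow> 'a"
    and A :: "nat \<Rightarrow> nat \<Rightarrow> 'b set"
  assumes mono: "\<And>E F. E \<subseteq> F \<Longrightarrow> C E \<le> C F"
    and cont: "\<And>E. incseq E \<Longrightarrow> C (\<Union>n. E n) = (SUP n. C (E n))"
    and outer: "\<And>E. C E = (INF U\<in>{U. E \<subseteq> U \<and> open U}. C U)"
    and A_inc: "\<And>i. incseq (A i)" and A_cover: "\<And>i. Y \<subseteq> (\<Union>j. A i j)"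
    and A_limit: "\<And>m y. (\<And>n. y n \<in> Y) \<Longrightarrow> (\<And>i. \<forall>\<^sub>F n in sequentially. y n \<in> A i (m i)) \<Longrightarrow>
        \<exists>l\<in>g ` Y. \<exists>r. strict_mono r \<and> (g \<circ> y \<circ> r) \<longlonglongrightarrow> l"
    and t: "t < C (g ` Y)"
  obtains K where "compact K" "K \<subseteq> g ` Y" "t \<le> C K"
proof -
  have "\<exists>T. \<forall>n. (T n \<subseteq> Y \<and> t < C (g ` T n)) \<and> (\<exists>j. T (Suc n) = T n \<inter> A n j)"
  proof (rule dependent_nat_choice)
    show "\<exists>T. T \<subseteq> Y \<and> t < C (g ` T)" using t by blast
    fix T n assume T: "T \<subseteq> Y \<and> t < C (g ` T)"
    have "incseq (\<lambda>j. g ` (T \<inter> A n j))"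
      using A_inc[of n] by (fastforce simp: incseq_def)
    moreover have "(\<Union>j. g ` (T \<inter> A n j)) = g ` T"
      using A_cover[of n] T by blast
    ultimately have "C (g ` T) = (SUP j. C (g ` (T \<inter> A n j)))"
      using cont[of "\<lambda>j. g ` (T \<inter> A n j)"] by simp
    then obtain j where "t < C (g ` (T \<inter> A n j))"
      using T by (auto simp: less_SUP_iff)
    then show "\<exists>T'. (T' \<subseteq> Y \<and> t < C (g ` T')) \<and> (\<exists>j. T' = T \<inter> A n j)"
      using T by blast
  qed
  then obtain T m where TY: "\<And>n. T n \<subseteq> Y" and tT: "\<And>n. t < C (g ` T n)"
    and T_Suc: "\<And>n. T (Suc n) = T n \<inter> A n (m n)"
    by metis
  have T_dec: "decseq T"
    by (rule decseq_SucI) (simp add: T_Suc)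
  have sub: "\<exists>l\<in>g ` Y. \<exists>r. strict_mono r \<and> (g \<circ> y \<circ> r) \<longlonglongrightarrow> l" if y: "\<And>n. y n \<in> T n" for y
  proof (rule A_limit[of y m])
    show "y n \<in> Y" for n using y TY by blast
    show "\<forall>\<^sub>F n in sequentially. y n \<in> A i (m i)" for i
    proof (rule eventually_sequentiallyI[of "Suc i"])
      fix n assume "Suc i \<le> n"
      then have "T n \<subseteq> T (Suc i)" using T_dec by (simp add: decseq_def)
      then show "y n \<in> A i (m i)" using y[of n] T_Suc[of i] by blast
    qed
  qed
  \<comment> \<open>\<open>K\<close> consists of the limits of the sequences \<open>g \<circ> y\<close> with \<open>y n \<in> T n\<close>.\<close>
  define K where "K = (\<Inter>n. closure (g ` T n))"
  have in_K: "l \<in> K" if y: "\<And>n. y n \<in> T n" and r: "strict_mono r" and l: "(g \<circ> y \<circ> r) \<longlonglongrightarrow> l"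
    for y r l
    unfolding K_def
  proof
    fix k
    have "\<forall>\<^sub>F n in sequentially. (g \<circ> y \<circ> r) n \<in> closure (g ` T k)"
    proof (rule eventually_sequentiallyI[of k])
      fix n assume "k \<le> n"
      then have "T (r n) \<subseteq> T k"
        using T_dec seq_suble[OF r, of n] by (simp add: decseq_def)
      then show "(g \<circ> y \<circ> r) n \<in> closure (g ` T k)"
        using y[of "r n"] closure_subset[of "g ` T k"] by auto
    qed
    then show "l \<in> closure (g ` T k)"
      using l by (intro Lim_in_closed_set[of "closure (g ` T k)" "g \<circ> y \<circ> r" sequentially]) auto
  qed
  have near: "\<exists>y. (\<forall>n. y n \<in> T n \<and> dist (g (y n)) (z n) < 1 / Suc n)" if z: "\<And>n. z n \<in> K" for z :: "nat \<Rightarrow> 'a"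
  proof -
    have "\<exists>y. y \<in> T n \<and> dist (g y) (z n) < 1 / Suc n" for n
    proof -
      have "z n \<in> closure (g ` T n)" using z[of n] by (simp add: K_def)
      then show ?thesis
        unfolding closure_approachable by (metis imageE of_nat_0_less_iff zero_less_Suc zero_less_divide_1_iff)
    qed
    then show ?thesis by metis
  qed
  have conv: "\<exists>l\<in>K \<inter> g ` Y. \<exists>r. strict_mono r \<and> (z \<circ> r) \<longlonglongrightarrow> l" if z: "\<And>n. z n \<in> K" for z :: "nat \<Rightarrow> 'a"
  proof -
    obtain y where y: "\<And>n. y n \<in> T n" "\<And>n. dist (g (y n)) (z n) < 1 / Suc n"
      using near[of z] z by blast
    obtain l r where l: "l \<in> g ` Y" and r: "strict_mono r" "(g \<circ> y \<circ> r) \<longlonglongrightarrow> l"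
      using sub[of y] y(1) by blast
    have "(\<lambda>n. dist (g (y n)) (z n)) \<longlonglongrightarrow> 0"
      by (rule tendsto_sandwich[OF _ _ tendsto_const LIMSEQ_Suc[OF lim_1_over_n]])
         (use y(2) in \<open>auto intro!: always_eventually less_imp_le\<close>)
    then have d: "(\<lambda>n. dist (g (y (r n))) (z (r n))) \<longlonglongrightarrow> 0"
      using LIMSEQ_subseq_LIMSEQ[OF _ r(1)] by (auto simp: o_def)
    have "(z \<circ> r) \<longlonglongrightarrow> l"
      unfolding tendsto_dist_iff[of "z \<circ> r"]
    proof (rule tendsto_sandwich[OF _ _ tendsto_const])
      have "(\<lambda>n. dist (g (y (r n))) l) \<longlonglongrightarrow> 0"
        using tendsto_dist_iff[THEN iffD1, OF r(2)] by (simp add: o_def)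
      from tendsto_add[OF d this]
      show "(\<lambda>n. dist (g (y (r n))) (z (r n)) + dist (g (y (r n))) l) \<longlonglongrightarrow> 0"
        by simp
    qed (auto intro!: always_eventually dist_triangle3)
    moreover have "l \<in> K" using in_K[OF y(1) r] .
    ultimately show ?thesis using l r(1) by blast
  qed
  show ?thesis
  proof (rule that)
    have "seq_compact K"
      unfolding seq_compact_def using conv by blast
    then show "compact K" by (simp add: compact_eq_seq_compact_metric)
    show "K \<subseteq> g ` Y"
    proof
      fix z assume "z \<in> K"
      then obtain l r where l: "l \<in> K \<inter> g ` Y" and r: "(((\<lambda>_. z) :: nat \<Rightarrow> 'a) \<circ> r) \<longlonglongrightarrow> l"
        using conv[of "\<lambda>_. z"] by metis
      from r have "z = l" by (simp add: o_def LIMSEQ_const_iff)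
      then show "z \<in> g ` Y" using l by simp
    qed
    have "t \<le> C U" if U: "K \<subseteq> U" "open U" for U
    proof -
      have "\<exists>n. g ` T n \<subseteq> U"
      proof (rule ccontr)
        assume "\<nexists>n. g ` T n \<subseteq> U"
        then have "\<forall>n. \<exists>y. y \<in> T n \<and> g y \<in> - U" by (simp add: image_subset_iff Bex_def)
        then obtain y where y: "\<And>n. y n \<in> T n" "\<And>n. g (y n) \<in> - U" by metis
        obtain l r where r: "strict_mono r" "(g \<circ> y \<circ> r) \<longlonglongrightarrow> l"
          using sub[of y] y(1) by blast
        have "l \<in> - U"
          by (rule Lim_in_closed_set[OF _ _ _ r(2)]) (use U y in auto)
        moreover have "l \<in> K" using in_K[OF y(1) r] .
        ultimately show False using U by blast
      qed
      then show ?thesis using tT mono by (metis less_imp_le order_trans)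
    qed
    then show "t \<le> C K"
      unfolding outer[of K] by (intro INF_greatest) auto
  qed
qed

text \<open>
  A sequence that, for each radius, is eventually in a finite union of balls of that radius is totally
  bounded, so completeness yields a convergent subsequence.
\<close>

lemma polish_ball_covers:
  fixes Y :: "'b topology"
  assumes "polish_topology Y" "topspace Y \<noteq> {}"
  obtains A :: "nat \<Rightarrow> nat \<Rightarrow> 'b set" where "\<And>i. incseq (A i)" "\<And>i. topspace Y \<subseteq> (\<Union>j. A i j)"
    "\<And>m y. (\<And>n. y n \<in> topspace Y) \<Longrightarrow> (\<And>i. \<forall>\<^sub>F n in sequentially. y n \<in> A i (m i)) \<Longrightarrow>
      \<exists>l r. strict_mono (r::nat\<Rightarrow>nat) \<and> limitin Y (y \<circ> r) l sequentially"
proof -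
  obtain M d where "Metric_space M d" and complete: "Metric_space.mcomplete M d"
    and Y: "Y = Metric_space.mtopology M d"
    using assms(1) unfolding polish_topology_def completely_metrizable_space_def by blast
  interpret Metric_space M d by fact
  obtain D where D: "countable D" "D \<subseteq> M" "mtopology closure_of D = M"
    using assms(1) unfolding polish_topology_def separable_space_def Y by auto
  have "D \<noteq> {}" using D assms(2) Y by auto
  then obtain e :: "nat \<Rightarrow> _" where e: "range e = D"
    using D(1) uncountable_def by metis
  define A where "A i j = (\<Union>k\<le>j. mball (e k) (1 / Suc i))" for i j
  show ?thesis
  proof (rule that[of A])
    show "incseq (A i)" for i
      by (force simp: incseq_def A_def)
    show "topspace Y \<subseteq> (\<Union>j. A i j)" for i
    proof
      fix x assume "x \<in> topspace Y"
      then have "x \<in> mtopology closure_of D" using D(3) Y by simp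
      then obtain k where "e k \<in> mball x (1 / Suc i)"
        unfolding metric_closure_of using e by (force dest: spec[of _ "1 / Suc i"])
      then show "x \<in> (\<Union>j. A i j)" by (auto simp: A_def commute)
    qed
    fix m y
    assume yY: "\<And>n. y n \<in> topspace Y" and ev: "\<And>i. \<forall>\<^sub>F n in sequentially. y n \<in> A i (m i)"
    have yM: "y n \<in> M" for n using yY Y by simp
    have "mtotally_bounded (range y)"
      unfolding mtotally_bounded_def
    proof (intro allI impI)
      fix \<epsilon> :: real assume \<epsilon>: "0 < \<epsilon>"
      then obtain i where i: "1 / Suc i < \<epsilon> / 2"
        using nat_approx_posE[of "\<epsilon> / 2"] by auto
      obtain N where N: "\<And>n. N \<le> n \<Longrightarrow> y n \<in> A i (m i)"
        using ev[of i] unfolding eventually_sequentially by blast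
      \<comment> \<open>Total boundedness asks for centres in the set itself, so each ball that meets the sequence is
        replaced by one of more than twice the radius around a point of the sequence.\<close>
      define pick where "pick k = (SOME x. x \<in> range y \<and> x \<in> mball (e k) (1 / Suc i))" for k
      define K where "K = y ` {..<N} \<union> pick ` {k. k \<le> m i \<and> range y \<inter> mball (e k) (1 / Suc i) \<noteq> {}}"
      have pick: "pick k \<in> range y \<and> pick k \<in> mball (e k) (1 / Suc i)"
        if "range y \<inter> mball (e k) (1 / Suc i) \<noteq> {}" for k
        unfolding pick_def by (rule someI_ex) (use that in blast)
      have "y n \<in> (\<Union>x\<in>K. mball x \<epsilon>)" for n
      proof (cases "n < N")
        case True
        then have "y n \<in> K" by (simp add: K_def)
        then show ?thesis using yM \<epsilon> by force
      next
        case False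
        then obtain k where k: "k \<le> m i" "y n \<in> mball (e k) (1 / Suc i)"
          using N[of n] by (auto simp: A_def)
        then have ne: "range y \<inter> mball (e k) (1 / Suc i) \<noteq> {}" by blast
        have "d (pick k) (y n) \<le> d (e k) (pick k) + d (e k) (y n)"
          using pick[OF ne] k by (metis commute in_mball triangle)
        then have "y n \<in> mball (pick k) \<epsilon>"
          using pick[OF ne] k i by auto
        then show ?thesis using k ne by (auto simp: K_def)
      qed
      moreover have "finite K" by (simp add: K_def)
      moreover have "K \<subseteq> range y" using pick by (auto simp: K_def)
      ultimately show "\<exists>K. finite K \<and> K \<subseteq> range y \<and> range y \<subseteq> (\<Union>x\<in>K. mball x \<epsilon>)"
        by blast
    qed
    then obtain r :: "nat \<Rightarrow> nat" where r: "strict_mono r" "MCauchy (y \<circ> r)"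
      unfolding mtotally_bounded_sequentially by blast
    then obtain l where "limitin mtopology (y \<circ> r) l sequentially"
      using complete unfolding mcomplete_def by blast
    then show "\<exists>l r. strict_mono (r::nat\<Rightarrow>nat) \<and> limitin Y (y \<circ> r) l sequentially"
      using r Y by blast
  qed
qed

section \<open>Covers of Borel sets\<close>

text \<open>
  The covers needed for Choquet's argument, for the identity map on a subset \<open>E\<close> of the space.  A Borel
  subset of a Polish space carries a finer Polish topology, and its covers by balls of that topology
  are of this kind; here such covers are constructed without changing the topology.
\<close>

definition compactly_resolvable :: "'a::metric_space set \<Rightarrow> bool" where
  "compactly_resolvable E \<longleftrightarrow>
     (\<exists>A :: nat \<Rightarrow> nat \<Rightarrow> 'a set. (\<forall>i. incseq (A i) \<and> E \<subseteq> (\<Union>j. A i j)) \<and>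
       (\<forall>m x. (\<forall>n. x n \<in> E) \<longrightarrow> (\<forall>i. \<forall>\<^sub>F n in sequentially. x n \<in> A i (m i)) \<longrightarrow>
          (\<exists>l\<in>E. \<exists>r. strict_mono r \<and> (x \<circ> r) \<longlonglongrightarrow> l)))"

lemma compactly_resolvable_sigma_compact:
  fixes K :: "nat \<Rightarrow> 'a::metric_space set"
  assumes K: "\<And>n. compact (K n)"
  shows "compactly_resolvable (\<Union>n. K n)"
proof -
  define L where "L j = (\<Union>n\<le>j. K n)" for j
  have L: "compact (L j)" "L j \<subseteq> (\<Union>n. K n)" for j
    using K by (auto simp: L_def intro!: compact_UN)
  have limit: "\<exists>l\<in>(\<Union>n. K n). \<exists>r. strict_mono r \<and> (x \<circ> r) \<longlonglongrightarrow> l"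
    if ev: "\<forall>i. \<forall>\<^sub>F n in sequentially. x n \<in> L (m i)" for m :: "nat \<Rightarrow> nat" and x
  proof -
    obtain N where N: "\<And>n. N \<le> n \<Longrightarrow> x n \<in> L (m 0)"
      using ev unfolding eventually_sequentially by blast
    then have "\<forall>n. (x \<circ> (+) N) n \<in> L (m 0)" by simp
    then obtain l r where r: "l \<in> L (m 0)" "strict_mono r" "((x \<circ> (+) N) \<circ> r) \<longlonglongrightarrow> l"
      using L(1)[of "m 0"] unfolding compact_eq_seq_compact_metric seq_compact_def by blast
    have "strict_mono ((+) N \<circ> r)"
      using r(2) by (simp add: strict_mono_def)
    then show ?thesis using r(1,3) L(2) by (metis comp_assoc subsetD)
  qed
  have "incseq L" by (force simp: incseq_def L_def)
  moreover have "(\<Union>n. K n) \<subseteq> (\<Union>j. L j)" by (auto simp: L_def)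
  ultimately show ?thesis
    unfolding compactly_resolvable_def using limit
    by (intro exI[of _ "\<lambda>_. L"] conjI allI impI) simp_all
qed

lemma compactly_resolvable_covers:
  fixes E :: "nat \<Rightarrow> 'a::metric_space set"
  assumes E: "\<And>k. compactly_resolvable (E k)"
  obtains A :: "nat \<Rightarrow> nat \<Rightarrow> nat \<Rightarrow> 'a set"
    where "\<And>k i. incseq (A k i)" "\<And>k i. E k \<subseteq> (\<Union>j. A k i j)"
      "\<And>k m x. (\<And>n. x n \<in> E k) \<Longrightarrow> (\<And>i. \<forall>\<^sub>F n in sequentially. x n \<in> A k i (m i)) \<Longrightarrow>
          \<exists>l\<in>E k. \<exists>r. strict_mono r \<and> (x \<circ> r) \<longlonglongrightarrow> l"
proof -
  have "\<forall>k. \<exists>A :: nat \<Rightarrow> nat \<Rightarrow> 'a set. (\<forall>i. incseq (A i) \<and> E k \<subseteq> (\<Union>j. A i j)) \<and>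
       (\<forall>m x. (\<forall>n. x n \<in> E k) \<longrightarrow> (\<forall>i. \<forall>\<^sub>F n in sequentially. x n \<in> A i (m i)) \<longrightarrow>
          (\<exists>l\<in>E k. \<exists>r. strict_mono r \<and> (x \<circ> r) \<longlonglongrightarrow> l))"
    using E unfolding compactly_resolvable_def by blast
  then obtain A :: "nat \<Rightarrow> nat \<Rightarrow> nat \<Rightarrow> 'a set"
    where A: "\<And>k i. incseq (A k i)" "\<And>k i. E k \<subseteq> (\<Union>j. A k i j)"
      and lim: "\<And>k m x. (\<And>n. x n \<in> E k) \<Longrightarrow> (\<And>i. \<forall>\<^sub>F n in sequentially. x n \<in> A k i (m i)) \<Longrightarrow>
          \<exists>l\<in>E k. \<exists>r. strict_mono r \<and> (x \<circ> r) \<longlonglongrightarrow> l"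
    by metis
  then show ?thesis by (rule that)
qed

text \<open>
  The covers of all the sets are used together, indexed by pairs.  The subsequence found for the first
  set converges to some \<open>l\<close>; every other set supplies a further subsequence, whose limit lies in that
  set and can only be \<open>l\<close>.
\<close>

lemma compactly_resolvable_INT:
  fixes E :: "nat \<Rightarrow> 'a::metric_space set"
  assumes E: "\<And>k. compactly_resolvable (E k)"
  shows "compactly_resolvable (\<Inter>k. E k)"
proof -
  obtain A :: "nat \<Rightarrow> nat \<Rightarrow> nat \<Rightarrow> 'a set"
    where A: "\<And>k i. incseq (A k i)" "\<And>k i. E k \<subseteq> (\<Union>j. A k i j)"
      and lim: "\<And>k m x. (\<And>n. x n \<in> E k) \<Longrightarrow> (\<And>i. \<forall>\<^sub>F n in sequentially. x n \<in> A k i (m i)) \<Longrightarrow>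
          \<exists>l\<in>E k. \<exists>r. strict_mono r \<and> (x \<circ> r) \<longlonglongrightarrow> l"
    by (rule compactly_resolvable_covers[of E, OF E]) blast
  define B where "B i = A (fst (prod_decode i)) (snd (prod_decode i))" for i
  have limit: "\<exists>l\<in>(\<Inter>k. E k). \<exists>r. strict_mono r \<and> (x \<circ> r) \<longlonglongrightarrow> l"
    if xE: "\<forall>n. x n \<in> (\<Inter>k. E k)" and ev: "\<forall>i. \<forall>\<^sub>F n in sequentially. x n \<in> B i (m i)" for m x
  proof -
    have evA: "\<forall>\<^sub>F n in sequentially. x n \<in> A k i (m (prod_encode (k, i)))" for k i
      using ev[rule_format, of "prod_encode (k, i)"] by (simp add: B_def)
    obtain l r where l: "l \<in> E 0" and r: "strict_mono r" "(x \<circ> r) \<longlonglongrightarrow> l"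
      using lim[OF _ evA, of 0] xE by blast
    have "l \<in> E k" for k
    proof -
      have "\<forall>\<^sub>F n in sequentially. (x \<circ> r) n \<in> A k i (m (prod_encode (k, i)))" for i
        using eventually_subseq[OF r(1) evA[of k i]] by simp
      moreover have "(x \<circ> r) n \<in> E k" for n using xE by simp
      ultimately obtain l' s where l': "l' \<in> E k" "strict_mono s" "((x \<circ> r) \<circ> s) \<longlonglongrightarrow> l'"
        using lim[of "x \<circ> r" k "\<lambda>i. m (prod_encode (k, i))"] by blast
      then have "l' = l"
        using LIMSEQ_subseq_LIMSEQ[OF r(2)] LIMSEQ_unique by blast
      then show ?thesis using l' by simp
    qed
    then show ?thesis using r by blast
  qed
  have "incseq (B i)" for i
    using A(1) by (simp add: B_def)
  moreover have "(\<Inter>k. E k) \<subseteq> (\<Union>j. B i j)" for i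
    using A(2)[of "fst (prod_decode i)" "snd (prod_decode i)"] by (auto simp: B_def)
  ultimately show ?thesis
    unfolding compactly_resolvable_def using limit
    by (intro exI[of _ B] conjI allI impI) simp_all
qed

text \<open>
  The first cover confines a sequence to finitely many of the sets, so a subsequence stays in one of
  them.  Disjointness ensures that the remaining covers, too, speak about that same set.
\<close>

lemma compactly_resolvable_disjoint_UN:
  fixes E :: "nat \<Rightarrow> 'a::metric_space set"
  assumes E: "\<And>k. compactly_resolvable (E k)" and disj: "disjoint_family E"
  shows "compactly_resolvable (\<Union>k. E k)"
proof -
  obtain A :: "nat \<Rightarrow> nat \<Rightarrow> nat \<Rightarrow> 'a set"
    where A: "\<And>k i. incseq (A k i)" "\<And>k i. E k \<subseteq> (\<Union>j. A k i j)"
      and lim: "\<And>k m x. (\<And>n. x n \<in> E k) \<Longrightarrow> (\<And>i. \<forall>\<^sub>F n in sequentially. x n \<in> A k i (m i)) \<Longrightarrow>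
          \<exists>l\<in>E k. \<exists>r. strict_mono r \<and> (x \<circ> r) \<longlonglongrightarrow> l"
    by (rule compactly_resolvable_covers[of E, OF E]) blast
  define B where "B i j = (\<Union>k\<le>j. E k \<inter> A k i j)" for i j
  have limit: "\<exists>l\<in>(\<Union>k. E k). \<exists>r. strict_mono r \<and> (x \<circ> r) \<longlonglongrightarrow> l"
    if ev: "\<forall>i. \<forall>\<^sub>F n in sequentially. x n \<in> B i (m i)" for m x
  proof -
    have "\<exists>k\<le>m 0. \<exists>\<^sub>F n in sequentially. x n \<in> E k"
    proof (rule ccontr)
      assume "\<not> ?thesis"
      then have "\<forall>k\<in>{..m 0}. \<forall>\<^sub>F n in sequentially. x n \<notin> E k"
        by (auto simp: not_frequently)
      then have "\<forall>\<^sub>F n in sequentially. \<forall>k\<in>{..m 0}. x n \<notin> E k"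
        by (simp add: eventually_ball_finite)
      then have "\<forall>\<^sub>F n in sequentially. False"
        using ev[rule_format, of 0] by eventually_elim (auto simp: B_def)
      then show False by simp
    qed
    then obtain k where "\<exists>\<^sub>F n in sequentially. x n \<in> E k" by blast
    then have inf: "infinite {n. x n \<in> E k}"
      by (simp add: frequently_cofinite cofinite_eq_sequentially[symmetric])
    define r where "r = enumerate {n. x n \<in> E k}"
    have r: "strict_mono r" "\<And>n. x (r n) \<in> E k"
      using strict_mono_enumerate[OF inf] enumerate_in_set[OF inf] by (auto simp: r_def)
    have "\<forall>\<^sub>F n in sequentially. (x \<circ> r) n \<in> A k i (m i)" for i
    proof -
      have "\<forall>\<^sub>F n in sequentially. x (r n) \<in> B i (m i)"
        using eventually_subseq[OF r(1) ev[rule_format, of i]] .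
      then show ?thesis
      proof eventually_elim
        case (elim n)
        then obtain k' where "x (r n) \<in> E k'" "x (r n) \<in> A k' i (m i)" by (auto simp: B_def)
        moreover have "k' = k"
          using r(2)[of n] \<open>x (r n) \<in> E k'\<close> disj by (auto simp: disjoint_family_on_def)
        ultimately show ?case by simp
      qed
    qed
    then obtain l s where l: "l \<in> E k" "strict_mono s" "((x \<circ> r) \<circ> s) \<longlonglongrightarrow> l"
      using lim[of "x \<circ> r" k m] r(2) by auto
    then have "strict_mono (r \<circ> s)" "(x \<circ> (r \<circ> s)) \<longlonglongrightarrow> l"
      using r(1) by (auto simp: strict_mono_o comp_assoc)
    then show ?thesis using l(1) by blast
  qed
  have "incseq (B i)" for i
    unfolding incseq_def B_def
  proof (intro allI impI UN_mono Int_mono order_refl)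
    fix a b k :: nat assume "a \<le> b"
    then show "{..a} \<subseteq> {..b}" "A k i a \<subseteq> A k i b"
      using A(1)[of k i] by (auto simp: incseq_def)
  qed
  moreover have "(\<Union>k. E k) \<subseteq> (\<Union>j. B i j)" for i
  proof
    fix x assume "x \<in> (\<Union>k. E k)"
    then obtain k j where kj: "x \<in> E k" "x \<in> A k i j" using A(2) by blast
    then have "x \<in> A k i (max k j)"
      using A(1)[of k i] by (metis incseqD max.cobounded2 subsetD)
    then have "x \<in> B i (max k j)" using kj by (auto simp: B_def)
    then show "x \<in> (\<Union>j. B i j)" by blast
  qed
  ultimately show ?thesis
    unfolding compactly_resolvable_def using limit
    by (intro exI[of _ B] conjI allI impI) simp_all
qed

text \<open>
  The sets that are resolvable together with their complements form a sigma-algebra containing the open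
  sets.  Complements are built in because unions are only available for disjoint sets: the sets
  \<open>disjointed F n\<close> are obtained from the \<open>F n\<close> by finite intersections and complements.
\<close>

lemma compactly_resolvable_borel:
  fixes K :: "nat \<Rightarrow> 'a::metric_space set" and E :: "'a set"
  assumes K: "\<And>n. compact (K n)" "(\<Union>n. K n) = UNIV" and E: "E \<in> sets borel"
  shows "compactly_resolvable E"
proof -
  define good where "good F \<longleftrightarrow> compactly_resolvable F \<and> compactly_resolvable (- F)" for F :: "'a set"
  have closed: "compactly_resolvable F" if "closed F" for F :: "'a set"
  proof -
    have "F = (\<Union>n. F \<inter> K n)" using K(2) by blast
    then show ?thesis
      using compactly_resolvable_sigma_compact[of "\<lambda>n. F \<inter> K n"] K(1) that
      by (simp add: closed_Int_compact)
  qed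
  have "open": "compactly_resolvable U" if "open U" for U :: "'a set"
  proof -
    have "fsigma_in euclidean U"
      using that by (simp add: open_imp_fsigma_in metrizable_space_euclidean)
    then obtain F :: "nat \<Rightarrow> 'a set" where F: "\<And>n. closed (F n)" "(\<Union>n. F n) = U"
      unfolding fsigma_in_ascending closed_closedin by auto
    define L where "L i = F (fst (prod_decode i)) \<inter> K (snd (prod_decode i))" for i
    have "x \<in> (\<Union>i. L i)" if xU: "x \<in> U" for x
    proof -
      obtain a b where "x \<in> F a" "x \<in> K b" using F(2) K(2) xU by blast
      then have "x \<in> L (prod_encode (a, b))" by (simp add: L_def)
      then show ?thesis by blast
    qed
    then have "U = (\<Union>i. L i)" using F(2) by (auto simp: L_def)
    then show ?thesis
      using compactly_resolvable_sigma_compact[of L] K(1) F(1)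
      by (simp add: L_def closed_Int_compact)
  qed
  have INT: "good (\<Inter>n. F n)" if F: "\<And>n. good (F n)" and "disjoint_family (\<lambda>n. - F n)" for F :: "nat \<Rightarrow> 'a set"
    using compactly_resolvable_INT[of F] compactly_resolvable_disjoint_UN[of "\<lambda>n. - F n"] that
    by (auto simp: good_def Compl_INT)
  have Int: "good (F \<inter> G)" if F: "good F" and G: "good G" for F G
  proof -
    have res: "compactly_resolvable (S \<inter> T)" if "compactly_resolvable S" "compactly_resolvable T" for S T :: "'a set"
    proof -
      have "(\<Inter>n. if n = (0::nat) then S else T) = S \<inter> T"
        by (auto split: if_splits)
      then show ?thesis
        using compactly_resolvable_INT[of "\<lambda>n. if n = (0::nat) then S else T"] that by simp
    qed
    have empty: "compactly_resolvable ({} :: 'a set)" by (rule closed) simp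
    have dj: "compactly_resolvable (S \<union> T)" if "compactly_resolvable S" "compactly_resolvable T" "S \<inter> T = {}" for S T :: "'a set"
    proof -
      have "compactly_resolvable (\<Union>n. if n = 0 then S else if n = (1::nat) then T else {})"
        by (rule compactly_resolvable_disjoint_UN) (use that empty in \<open>auto simp: disjoint_family_on_def\<close>)
      also have "(\<Union>n. if n = 0 then S else if n = (1::nat) then T else {}) = S \<union> T"
        by (auto split: if_splits)
      finally show ?thesis .
    qed
    have "- (F \<inter> G) = - F \<union> (F \<inter> - G)" by blast
    then show ?thesis
      using res[of F G] dj[of "- F" "F \<inter> - G"] res[of F "- G"] F G by (auto simp: good_def)
  qed
  have good_Compl: "good (- F)" if "good F" for F using that by (simp add: good_def)
  have "E \<in> sigma_sets UNIV (Collect open)"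
    using E by (simp add: borel_def sets_measure_of_conv)
  then have "good E"
  proof induction
    case (Basic U)
    then show ?case using "open"[of U] closed[of "- U"] by (simp add: good_def closed_Compl)
  next
    case Empty
    show ?case using "open"[of "{}"] closed[of UNIV] by (simp add: good_def)
  next
    case (Compl F)
    then show ?case using good_Compl by (simp add: Compl_eq_Diff_UNIV)
  next
    case (Union F)
    have prefix: "good (\<Inter>i\<in>{..<n}. - F i)" for n
    proof (induction n)
      case 0
      show ?case using "open"[of "{}"] closed[of UNIV] by (simp add: good_def)
    next
      case (Suc n)
      then show ?case using Int[OF good_Compl[OF Union.IH[of n]]] by (simp add: lessThan_Suc)
    qed
    have "good (F n \<inter> (\<Inter>i\<in>{..<n}. - F i))" for n
      using Int[OF Union.IH prefix] .
    moreover have eq: "F n \<inter> (\<Inter>i\<in>{..<n}. - F i) = disjointed F n" for n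
      by (auto simp: disjointed_def)
    ultimately have "good (- disjointed F n)" for n
      using good_Compl by simp
    then have "good (\<Inter>n. - disjointed F n)"
      by (intro INT) (simp_all add: disjoint_family_disjointed)
    then have "good (- (\<Inter>n. - disjointed F n))" by (rule good_Compl)
    then show ?case
      using UN_disjointed_eq[of F] by (simp add: Compl_INT)
  qed
  then show ?thesis by (simp add: good_def)
qed

section \<open>Separability and sigma-compactness\<close>

lemma maximal_separated_set:
  fixes e :: real
  obtains S :: "'a::metric_space set"
  where "\<And>x y. x \<in> S \<Longrightarrow> y \<in> S \<Longrightarrow> x \<noteq> y \<Longrightarrow> e \<le> dist x y"
    "\<And>x. x \<notin> S \<Longrightarrow> \<exists>s\<in>S. dist x s < e"
proof -
  define sep where "sep S \<longleftrightarrow> (\<forall>x\<in>S. \<forall>y\<in>S. x \<noteq> y \<longrightarrow> e \<le> dist x y)" for S :: "'a set"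
  have "\<exists>S\<in>Collect sep. \<forall>T\<in>Collect sep. S \<subseteq> T \<longrightarrow> T = S"
  proof (rule subset_Zorn')
    fix C assume C: "subset.chain (Collect sep) C"
    have "e \<le> dist x y" if xy: "x \<in> \<Union>C" "y \<in> \<Union>C" "x \<noteq> y" for x y
    proof -
      obtain A B where AB: "A \<in> C" "x \<in> A" "B \<in> C" "y \<in> B" using xy by blast
      then have "A \<subseteq> B \<or> B \<subseteq> A" using C unfolding subset.chain_def by blast
      moreover have "sep A" "sep B" using AB C unfolding subset.chain_def by blast+
      ultimately show ?thesis using AB xy(3) unfolding sep_def by blast
    qed
    then show "\<Union>C \<in> Collect sep" by (simp add: sep_def)
  qed
  then obtain S where S: "sep S" "\<And>T. sep T \<Longrightarrow> S \<subseteq> T \<Longrightarrow> T = S" by blast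
  show ?thesis
  proof (rule that[of S])
    show "e \<le> dist x y" if "x \<in> S" "y \<in> S" "x \<noteq> y" for x y
      using S(1) that by (simp add: sep_def)
    show "\<exists>s\<in>S. dist x s < e" if x: "x \<notin> S" for x
    proof (rule ccontr)
      assume "\<not> ?thesis"
      then have "sep (insert x S)"
        using S(1) unfolding sep_def by (auto simp: not_less dist_commute)
      then show False using S(2)[of "insert x S"] x by blast
    qed
  qed
qed

text \<open>
  Balls of radius \<open>e/2\<close> around the points of \<open>S\<close> are disjoint.  Within a given ball of finite measure,
  only finitely many of them can have measure more than \<open>1/(n+1)\<close>.
\<close>

lemma countable_separated_set:
  fixes M :: "'a::metric_space measure" and S :: "'a set"
  assumes M: "sets borel \<subseteq> sets M"
    and ball: "\<And>x r. 0 < r \<Longrightarrow> 0 < emeasure M (ball x r) \<and> emeasure M (ball x r) < \<infinity>"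
    and e: "0 < e" and S: "\<And>x y. x \<in> S \<Longrightarrow> y \<in> S \<Longrightarrow> x \<noteq> y \<Longrightarrow> e \<le> dist x y"
  shows "countable S"
proof -
  fix x0 :: 'a
  define T where "T R n = {s \<in> S. dist x0 s < real R \<and> ennreal (1 / Suc n) < emeasure M (ball s (e / 2))}" for R n
  have "finite (T R n)" for R n
  proof -
    define V where "V = enn2real (emeasure M (ball x0 (real R + e)))"
    have V: "emeasure M (ball x0 (real R + e)) = ennreal V"
      unfolding V_def using ball[of "real R + e" x0] e by simp
    have "card F \<le> nat \<lceil>Suc n * V\<rceil>" if F: "F \<subseteq> T R n" "finite F" for F
    proof -
      have "ennreal (card F * (1 / Suc n)) = (\<Sum>s\<in>F. ennreal (1 / Suc n))"
        by (simp add: ennreal_of_nat_eq_real_of_nat flip: ennreal_mult)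
      also have "\<dots> \<le> (\<Sum>s\<in>F. emeasure M (ball s (e / 2)))"
        using F by (intro sum_mono) (auto simp: T_def)
      also have "\<dots> = emeasure M (\<Union>s\<in>F. ball s (e / 2))"
      proof (intro sum_emeasure)
        show "disjoint_family_on (\<lambda>s. ball s (e / 2)) F"
          unfolding disjoint_family_on_def
        proof (intro ballI impI)
          fix s t assume st: "s \<in> F" "t \<in> F" "s \<noteq> t"
          then have "e \<le> dist s t" using F S by (auto simp: T_def)
          then show "ball s (e / 2) \<inter> ball t (e / 2) = {}"
            by (intro disjoint_ballI) simp
        qed
      qed (use F M in auto)
      also have "\<dots> \<le> emeasure M (ball x0 (real R + e))"
      proof (rule emeasure_mono)
        have "dist x0 z < R + e" if "s \<in> F" "dist s z < e / 2" for s z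
          using that F e dist_triangle[of x0 z s] by (force simp: T_def)
        then show "(\<Union>s\<in>F. ball s (e / 2)) \<subseteq> ball x0 (real R + e)" by auto
      qed (use M in auto)
      finally have "card F * (1 / Suc n) \<le> V"
        unfolding V by (subst (asm) ennreal_le_iff) (auto simp: V_def)
      then have "card F \<le> Suc n * V" by (simp add: field_simps)
      then show ?thesis by linarith
    qed
    then show ?thesis using finite_if_finite_subsets_card_bdd[of "T R n"] by blast
  qed
  then have "countable (\<Union>R. \<Union>n. T R n)"
    by (intro countable_UN) (auto intro: countable_finite)
  moreover have "S \<subseteq> (\<Union>R. \<Union>n. T R n)"
  proof
    fix s assume s: "s \<in> S"
    obtain R :: nat where R: "dist x0 s < real R" using reals_Archimedean2 by blast
    define v where "v = enn2real (emeasure M (ball s (e / 2)))"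
    have v: "emeasure M (ball s (e / 2)) = ennreal v" "0 < v"
      using ball[of "e / 2" s] e by (auto simp: v_def enn2real_positive_iff)
    obtain n where "1 / Suc n < v" using v(2) nat_approx_posE by blast
    then have "s \<in> T R n" using s R v by (auto simp: T_def ennreal_less_iff)
    then show "s \<in> (\<Union>R. \<Union>n. T R n)" by blast
  qed
  ultimately show ?thesis by (rule countable_subset[rotated])
qed

text \<open>
  Maximal separated sets for the separations \<open>1/(n+1)\<close> together form a countable dense set.  The compact
  balls with radii \<open>1/(n+1)\<close> around its points then cover the locally compact space.
\<close>

lemma locally_compact_sigma_compact:
  fixes M :: "'a::metric_space measure"
  assumes lc: "locally_compact_space (euclidean :: 'a topology)"
    and M: "sets borel \<subseteq> sets M"
    and ball: "\<And>x r. 0 < r \<Longrightarrow> 0 < emeasure M (ball x r) \<and> emeasure M (ball x r) < \<infinity>"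
  obtains K :: "nat \<Rightarrow> 'a set" where "\<And>n. compact (K n)" "(\<Union>n. K n) = UNIV"
proof -
  have "\<exists>S :: 'a set. countable S \<and> (\<forall>x. \<exists>s\<in>S. dist x s < 1 / Suc n)" for n :: nat
  proof -
    obtain S :: "'a set" where S: "\<And>x y. x \<in> S \<Longrightarrow> y \<in> S \<Longrightarrow> x \<noteq> y \<Longrightarrow> 1 / Suc n \<le> dist x y"
      "\<And>x. x \<notin> S \<Longrightarrow> \<exists>s\<in>S. dist x s < 1 / Suc n"
      using maximal_separated_set[of "1 / Suc n", where ?'a = 'a] by metis
    have "countable S"
      by (rule countable_separated_set[OF M ball _ S(1)]) auto
    moreover have "\<exists>s\<in>S. dist x s < 1 / Suc n" for x
      using S(2)[of x] by (cases "x \<in> S") (auto intro!: bexI[of _ x])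
    ultimately show ?thesis by blast
  qed
  then obtain S :: "nat \<Rightarrow> 'a set" where S: "\<And>n. countable (S n)" "\<And>n x. \<exists>s\<in>S n. dist x s < 1 / Suc n"
    by metis
  \<comment> \<open>The empty set is added below so that an enumeration exists in any case.\<close>
  define \<K> where "\<K> = {L. compact L \<and> (\<exists>n. \<exists>s\<in>S n. L = cball s (1 / Suc n))}"
  have "countable (\<Union>n. (\<lambda>s. cball s (1 / Suc n)) ` S n)"
    using S(1) by auto
  then have count: "countable (insert {} \<K>)"
    by (intro countable_insert) (rule countable_subset[rotated], auto simp: \<K>_def)
  have cover: "x \<in> \<Union>\<K>" for x
  proof -
    obtain U L where UL: "open U" "compact L" "x \<in> U" "U \<subseteq> L"
      using lc unfolding locally_compact_space_def by simp metis
    then obtain e where e: "0 < e" "cball x e \<subseteq> U" using open_contains_cball by blast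
    obtain n where n: "1 / Suc n < e / 2" using nat_approx_posE[of "e / 2"] e(1) by auto
    obtain s where s: "s \<in> S n" "dist x s < 1 / Suc n" using S(2) by blast
    have "dist x z \<le> e" if "dist s z \<le> 1 / Suc n" for z
      using that s n dist_triangle[of x z s] by linarith
    then have "cball s (1 / Suc n) \<subseteq> L" using e(2) UL(4) by (auto simp: subset_iff)
    then have "compact (cball s (1 / Suc n))"
      using UL(2) by (metis closed_cball compact_Int_closed inf.absorb2)
    then show ?thesis using s by (auto simp: \<K>_def dist_commute intro!: exI[of _ n])
  qed
  define K where "K = from_nat_into (insert {} \<K>)"
  have K: "range K = insert {} \<K>"
    unfolding K_def by (rule range_from_nat_into[OF _ count]) simp
  show ?thesis
  proof (rule that[of K])
    show "compact (K n)" for n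
    proof -
      have "K n \<in> insert {} \<K>" unfolding K[symmetric] by simp
      then show ?thesis by (auto simp: \<K>_def)
    qed
    show "(\<Union>n. K n) = UNIV" unfolding K using cover by auto
  qed
qed

section \<open>Riesz potentials\<close>

lemma caratheodory_borel:
  assumes "outer_measure_space (Pow UNIV) \<mu>" "borel_regular \<mu>"
  shows sets_borel_subset_caratheodory: "sets borel \<subseteq> sets (caratheodory_measure \<mu>)"
    and emeasure_caratheodory_borel: "A \<in> sets borel \<Longrightarrow> emeasure (caratheodory_measure \<mu>) A = \<mu> A"
  using assms sets_caratheodory_measure[OF assms(1)] emeasure_caratheodory_measure[OF assms(1)]
  unfolding borel_regular_def by auto

locale riesz_setting =
  fixes \<mu> :: "'a::metric_space set \<Rightarrow> ennreal" and p \<gamma> :: real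
  assumes outer: "outer_measure_space (Pow UNIV) \<mu>"
    and regular: "borel_regular \<mu>"
    and ball: "\<And>x r. 0 < r \<Longrightarrow> 0 < \<mu> (ball x r) \<and> \<mu> (ball x r) < \<infinity>"
    and sphere: "\<And>x r. 0 < r \<Longrightarrow> \<mu> (sphere x r) = 0"
    and p: "1 < p" and \<gamma>: "\<gamma> < 1"
begin

abbreviation M :: "'a measure" where "M \<equiv> caratheodory_measure \<mu>"

abbreviation pot :: "('a \<Rightarrow> real) \<Rightarrow> 'a \<Rightarrow> ennreal" where "pot \<equiv> riesz_potential \<mu> \<gamma>"

abbreviation cap :: "'a set \<Rightarrow> ennreal" where "cap \<equiv> riesz_capacity \<mu> \<gamma> p"

abbreviation energy :: "('a \<Rightarrow> real) \<Rightarrow> ennreal" where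
  "energy f \<equiv> \<integral>\<^sup>+x. ennreal (f x powr p) \<partial>M"

definition vol :: "'a \<Rightarrow> real \<Rightarrow> real" where "vol x r = enn2real (\<mu> (ball x r))"

lemmas borel_M = sets_borel_subset_caratheodory[OF outer regular]
lemmas emeasure_borel = emeasure_caratheodory_borel[OF outer regular]

lemma space_M [simp]: "space M = UNIV"
  by (rule space_caratheodory_measure[OF outer])

lemma borel_measurable_M: "f \<in> measurable M N"
  if "f \<in> measurable borel N" for f :: "'a \<Rightarrow> 'c" and N
  using that borel_M by (auto simp: measurable_def)

lemma emeasure_ball: "emeasure M (ball x r) = ennreal (vol x r)"
proof (cases "0 < r")
  case True
  then show ?thesis using ball[OF True, of x] emeasure_borel[of "ball x r"] by (simp add: vol_def)
next
  case False
  then have empty: "ball x r = {}" by simp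
  have "\<mu> {} = 0" using emeasure_borel[of "{}"] by simp
  then show ?thesis
    unfolding vol_def empty by simp
qed

lemma sets_borel_M: "A \<in> sets borel \<Longrightarrow> A \<in> sets M"
  using borel_M by blast

lemma sets_ball [simp]: "ball x r \<in> sets M"
  by (rule sets_borel_M) simp

lemma vol_pos: "0 < r \<Longrightarrow> 0 < vol x r"
  using ball[of r x] by (simp add: vol_def enn2real_positive_iff)

lemma vol_nonneg [simp]: "0 \<le> vol x r"
  by (simp add: vol_def)

lemma vol_mono: "ball x r \<subseteq> ball y s \<Longrightarrow> vol x r \<le> vol y s"
  using emeasure_mono[of "ball x r" "ball y s" M] by (simp add: emeasure_ball)

lemma pot_eq: "pot f x = (\<integral>\<^sup>+y. ennreal (f y / vol x (dist x y) powr (1 - \<gamma>)) * indicator (- {x}) y \<partial>M)"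
  by (simp add: riesz_potential_def vol_def)

lemma integrand_measurable:
  assumes "f \<in> borel_measurable M"
  shows "(\<lambda>y. ennreal (f y / vol x (dist x y) powr (1 - \<gamma>)) * indicator (- {x}) y) \<in> borel_measurable M"
proof -
  have "mono (vol x)"
    by (intro monoI vol_mono) auto
  then have "vol x \<in> borel_measurable borel"
    by (rule borel_measurable_mono)
  then have "(\<lambda>y. vol x (dist x y)) \<in> borel_measurable borel"
    by (rule measurable_compose[OF borel_measurable_continuous_onI, rotated]) (intro continuous_intros)
  then have "(\<lambda>y. vol x (dist x y)) \<in> borel_measurable M"
    by (rule borel_measurable_M)
  moreover have "- {x} \<in> sets M" by (rule sets_borel_M) simp
  ultimately show ?thesis
    using assms by measurable
qed

text \<open>
  If \<open>X n\<close> is close to \<open>x\<close>, the ball \<open>ball (X n) (dist (X n) y)\<close> lies in a slightly enlarged copy of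
  \<open>ball x (dist x y)\<close>.  As the radius decreases to \<open>dist x y\<close>, the measure of these copies tends to that
  of the closed ball, which equals that of the open ball because spheres are null sets.
\<close>

lemma vol_upper_semicontinuous:
  assumes X: "X \<longlonglongrightarrow> x" and xy: "x \<noteq> y" and a: "vol x (dist x y) < a"
  shows "\<forall>\<^sub>F n in sequentially. vol (X n) (dist (X n) y) < a"
proof -
  define d where "d = dist x y"
  have d: "0 < d" using xy by (simp add: d_def)
  have "(\<lambda>k. emeasure M (ball x (d + 1 / Suc k))) \<longlonglongrightarrow> emeasure M (\<Inter>k. ball x (d + 1 / Suc k))"
  proof (rule Lim_emeasure_decseq)
    show "decseq (\<lambda>k. ball x (d + 1 / Suc k))"
      unfolding decseq_def by (auto simp: frac_le intro!: subset_ball)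
  qed (auto simp: emeasure_ball)
  also have "(\<Inter>k. ball x (d + 1 / Suc k)) = cball x d"
  proof (intro equalityI subsetI)
    fix z assume z: "z \<in> (\<Inter>k. ball x (d + 1 / Suc k))"
    show "z \<in> cball x d"
    proof (rule ccontr)
      assume "z \<notin> cball x d"
      then obtain k where "1 / Suc k < dist x z - d"
        using nat_approx_posE[of "dist x z - d"] by auto
      moreover have "dist x z < d + 1 / Suc k" using z by auto
      ultimately show False by simp
    qed
  qed (auto intro: le_less_trans)
  also have "emeasure M (cball x d) = emeasure M (ball x d)"
  proof (rule antisym)
    have "sphere x d = cball x d - ball x d" by auto
    also have "\<dots> \<in> sets borel" by (intro sets.Diff borel_closed borel_open) auto
    finally have sph: "sphere x d \<in> sets borel" .
    have "cball x d = ball x d \<union> sphere x d" by auto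
    then have "emeasure M (cball x d) \<le> emeasure M (ball x d) + emeasure M (sphere x d)"
      using emeasure_subadditive[OF sets_ball sets_borel_M[OF sph]] by simp
    then show "emeasure M (cball x d) \<le> emeasure M (ball x d)"
      using sphere[OF d, of x] emeasure_borel[OF sph] by simp
    show "emeasure M (ball x d) \<le> emeasure M (cball x d)"
      by (intro emeasure_mono) (auto simp: sets_borel_M)
  qed
  finally have "(\<lambda>k. vol x (d + 1 / Suc k)) \<longlonglongrightarrow> vol x d"
    by (simp add: emeasure_ball)
  then have "\<forall>\<^sub>F k in sequentially. vol x (d + 1 / Suc k) < a"
    using a by (simp add: order_tendstoD d_def)
  then obtain k where k: "vol x (d + 1 / Suc k) < a"
    by (auto simp: eventually_sequentially)
  define e where "e = 1 / real (Suc k)"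
  have e: "0 < e" "vol x (d + e) < a" using k by (simp_all add: e_def)
  have "\<forall>\<^sub>F n in sequentially. dist (X n) x < e / 2"
    by (rule tendstoD[OF X]) (use e in simp)
  then show ?thesis
  proof eventually_elim
    case (elim n)
    have "ball (X n) (dist (X n) y) \<subseteq> ball x (d + e)"
    proof
      fix z assume "z \<in> ball (X n) (dist (X n) y)"
      then have "dist x z < d + e"
        using elim dist_triangle[of x z "X n"] dist_triangle[of "X n" y x]
        unfolding d_def mem_ball dist_commute[of x "X n"] by linarith
      then show "z \<in> ball x (d + e)" by simp
    qed
    then show ?case using e(2) vol_mono by (meson le_less_trans)
  qed
qed

text \<open>
  The kernel has a negative power of the volume, so upper semicontinuity of the volume becomes lower
  semicontinuity of the kernel.
\<close>

lemma integrand_le_liminf: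
  assumes X: "X \<longlonglongrightarrow> x" and xy: "x \<noteq> y" and c: "0 \<le> c"
  shows "ennreal (c / vol x (dist x y) powr (1 - \<gamma>)) * indicator (- {x}) y
    \<le> liminf (\<lambda>n. ennreal (c / vol (X n) (dist (X n) y) powr (1 - \<gamma>)) * indicator (- {X n}) y)"
    (is "_ \<le> liminf ?F")
proof -
  define v where "v = vol x (dist x y)"
  have v: "0 < v" using xy by (simp add: v_def vol_pos)
  have ne: "\<forall>\<^sub>F n in sequentially. X n \<noteq> y"
    using tendsto_imp_eventually_ne[OF X xy] .
  have "ennreal (c / (v + 1 / Suc j) powr (1 - \<gamma>)) \<le> liminf ?F" for j
  proof (rule Liminf_bounded)
    have "\<forall>\<^sub>F n in sequentially. vol (X n) (dist (X n) y) < v + 1 / Suc j"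
      by (rule vol_upper_semicontinuous[OF X xy]) (simp add: v_def)
    then show "\<forall>\<^sub>F n in sequentially. ennreal (c / (v + 1 / Suc j) powr (1 - \<gamma>)) \<le> ?F n"
      using ne
    proof eventually_elim
      case (elim n)
      have "vol (X n) (dist (X n) y) powr (1 - \<gamma>) \<le> (v + 1 / Suc j) powr (1 - \<gamma>)"
        using elim \<gamma> by (intro powr_mono2) auto
      moreover have "0 < vol (X n) (dist (X n) y) powr (1 - \<gamma>)"
        using vol_pos[of "dist (X n) y" "X n"] elim by simp
      ultimately show ?case
        using elim c by (auto intro!: ennreal_leI frac_le)
    qed
  qed
  moreover have "(\<lambda>j. ennreal (c / (v + 1 / Suc j) powr (1 - \<gamma>))) \<longlonglongrightarrow> ennreal (c / (v + 0) powr (1 - \<gamma>))"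
    by (intro tendsto_intros tendsto_ennrealI LIMSEQ_Suc[OF lim_1_over_n]) (use v in auto)
  ultimately have "ennreal (c / v powr (1 - \<gamma>)) \<le> liminf ?F"
    by (intro LIMSEQ_le_const2[of "\<lambda>j. ennreal (c / (v + 1 / Suc j) powr (1 - \<gamma>))"]) auto
  then show ?thesis using xy by (simp add: v_def)
qed

text \<open>
  Potentials are lower semicontinuous by Fatou's lemma.  The diagonal causes no exception: at \<open>y = x\<close>
  the integrand of the limit is zero, and any other \<open>y\<close> differs from \<open>X n\<close> for large \<open>n\<close>.
\<close>

lemma open_pot_greater:
  assumes f: "f \<in> borel_measurable M" "\<And>x. 0 \<le> f x"
  shows "open {x. c < pot f x}"
proof -
  have "closed {x. pot f x \<le> c}"
    unfolding closed_sequential_limits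
  proof (intro allI impI, elim conjE)
    fix X x assume le: "\<forall>n. X n \<in> {x. pot f x \<le> c}" and X: "X \<longlonglongrightarrow> x"
    have "pot f x \<le> (\<integral>\<^sup>+y. liminf (\<lambda>n. ennreal (f y / vol (X n) (dist (X n) y) powr (1 - \<gamma>)) * indicator (- {X n}) y) \<partial>M)"
      unfolding pot_eq
    proof (rule nn_integral_mono)
      fix y
      show "ennreal (f y / vol x (dist x y) powr (1 - \<gamma>)) * indicator (- {x}) y
        \<le> liminf (\<lambda>n. ennreal (f y / vol (X n) (dist (X n) y) powr (1 - \<gamma>)) * indicator (- {X n}) y)"
        using integrand_le_liminf[OF X _ f(2)] by (cases "x = y") auto
    qed
    also have "\<dots> \<le> liminf (\<lambda>n. pot f (X n))"
      unfolding pot_eq by (intro nn_integral_liminf integrand_measurable f)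
    also have "\<dots> \<le> c"
      using le by (intro Liminf_le always_eventually) auto
    finally show "x \<in> {x. pot f x \<le> c}" by simp
  qed
  moreover have "{x. c < pot f x} = - {x. pot f x \<le> c}" by auto
  ultimately show ?thesis by (metis open_closed double_complement)
qed

lemma pot_mono_AE:
  assumes "AE y in M. f y \<le> g y"
  shows "pot f x \<le> pot g x"
  unfolding pot_eq
proof (rule nn_integral_mono_AE)
  show "AE y in M. ennreal (f y / vol x (dist x y) powr (1 - \<gamma>)) * indicator (- {x}) y
      \<le> ennreal (g y / vol x (dist x y) powr (1 - \<gamma>)) * indicator (- {x}) y"
    using assms by eventually_elim (intro mult_right_mono ennreal_leI divide_right_mono, auto)
qed

lemma pot_cmult:
  assumes "f \<in> borel_measurable M" "0 \<le> c"
  shows "pot (\<lambda>y. c * f y) x = ennreal c * pot f x"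
proof -
  have "pot (\<lambda>y. c * f y) x = (\<integral>\<^sup>+y. ennreal c * (ennreal (f y / vol x (dist x y) powr (1 - \<gamma>)) * indicator (- {x}) y) \<partial>M)"
    unfolding pot_eq using assms(2) by (intro nn_integral_cong) (simp add: ennreal_mult' flip: times_divide_eq_right mult.assoc)
  also have "\<dots> = ennreal c * pot f x"
    unfolding pot_eq by (rule nn_integral_cmult[OF integrand_measurable[OF assms(1)]])
  finally show ?thesis .
qed

lemma pot_add:
  assumes "f \<in> borel_measurable M" "g \<in> borel_measurable M" "\<And>x. 0 \<le> f x" "\<And>x. 0 \<le> g x"
  shows "pot (\<lambda>y. f y + g y) x = pot f x + pot g x"
proof -
  have "pot (\<lambda>y. f y + g y) x = (\<integral>\<^sup>+y. ennreal (f y / vol x (dist x y) powr (1 - \<gamma>)) * indicator (- {x}) y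
      + ennreal (g y / vol x (dist x y) powr (1 - \<gamma>)) * indicator (- {x}) y \<partial>M)"
    unfolding pot_eq using assms by (intro nn_integral_cong) (simp add: add_divide_distrib distrib_right)
  also have "\<dots> = pot f x + pot g x"
    unfolding pot_eq by (intro nn_integral_add integrand_measurable assms)
  finally show ?thesis .
qed

lemma pot_midpoint:
  assumes "f \<in> borel_measurable M" "g \<in> borel_measurable M" "\<And>x. 0 \<le> f x" "\<And>x. 0 \<le> g x"
    and "1 \<le> pot f x" "1 \<le> pot g x"
  shows "1 \<le> pot (\<lambda>y. (f y + g y) / 2) x"
proof -
  have "1 = ennreal (1 / 2 * (1 + 1))" by simp
  also have "\<dots> = ennreal (1 / 2) * (ennreal 1 + ennreal 1)"
    unfolding ennreal_plus[OF zero_le_one zero_le_one, symmetric] by (rule ennreal_mult) auto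
  also have "\<dots> \<le> ennreal (1 / 2) * (pot f x + pot g x)"
    using assms by (intro mult_left_mono add_mono) auto
  also have "\<dots> = pot (\<lambda>y. 1 / 2 * (f y + g y)) x"
    using assms by (simp add: pot_cmult pot_add del: times_divide_eq_left)
  finally show ?thesis by simp
qed

section \<open>Outer regularity and continuity of the Riesz capacity\<close>

lemma energy_eq_Lp_norm:
  assumes "f \<in> Lp_plus \<mu> p"
  shows "ennreal (Lp_norm \<mu> p f powr p) = energy f"
proof -
  have f: "\<And>x. 0 \<le> f x" "integrable M (\<lambda>x. \<bar>f x\<bar> powr p)"
    using assms by (auto simp: Lp_plus_def)
  have "Lp_norm \<mu> p f powr p = (\<integral>x. \<bar>f x\<bar> powr p \<partial>M)"
    using p by (simp add: Lp_norm_def powr_powr)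
  then show ?thesis
    using nn_integral_eq_integral[OF f(2)] f(1) by simp
qed

lemma cap_le_energy:
  assumes f: "f \<in> borel_measurable M" "\<And>x. 0 \<le> f x" and E: "\<And>x. x \<in> E \<Longrightarrow> 1 \<le> pot f x"
  shows "cap E \<le> energy f"
proof (cases "energy f = \<infinity>")
  case False
  have "integrable M (\<lambda>x. \<bar>f x\<bar> powr p)"
    using f False by (intro integrableI_nonneg) (auto simp: less_top)
  then have L: "f \<in> Lp_plus \<mu> p"
    using f by (simp add: Lp_plus_def)
  then have "f \<in> riesz_admissible \<mu> \<gamma> p E"
    using E by (simp add: riesz_admissible_def)
  then have "cap E \<le> ennreal (Lp_norm \<mu> p f powr p)"
    unfolding riesz_capacity_def by (rule INF_lower)
  then show ?thesis
    using energy_eq_Lp_norm[OF L] by simp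
qed simp

lemma cap_lessE:
  assumes "cap E < c"
  obtains f where "f \<in> borel_measurable M" "\<And>x. 0 \<le> f x" "\<And>x. x \<in> E \<Longrightarrow> 1 \<le> pot f x" "energy f < c"
proof -
  obtain f where f: "f \<in> riesz_admissible \<mu> \<gamma> p E" "ennreal (Lp_norm \<mu> p f powr p) < c"
    using assms unfolding riesz_capacity_def INF_less_iff by blast
  then have "f \<in> Lp_plus \<mu> p" "\<And>x. x \<in> E \<Longrightarrow> 1 \<le> pot f x"
    by (auto simp: riesz_admissible_def)
  moreover have "f \<in> borel_measurable M" "\<And>x. 0 \<le> f x"
    using \<open>f \<in> Lp_plus \<mu> p\<close> by (auto simp: Lp_plus_def)
  ultimately show ?thesis
    using that[of f] f(2) energy_eq_Lp_norm[of f] by simp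
qed

lemma cap_mono: "E \<subseteq> F \<Longrightarrow> cap E \<le> cap F"
  unfolding riesz_capacity_def
  by (rule INF_superset_mono) (auto simp: riesz_admissible_def)

text \<open>
  If \<open>f\<close> is admissible for \<open>E\<close> and \<open>s > 1\<close>, the set where the potential of \<open>s f\<close> exceeds \<open>1\<close> contains \<open>E\<close>
  and is open by lower semicontinuity.  Hence an open neighbourhood of \<open>E\<close> has capacity at most
  \<open>s powr p\<close> times the energy of \<open>f\<close>; let \<open>s\<close> decrease to \<open>1\<close>.
\<close>

lemma cap_outer_regular: "cap E = (INF U\<in>{U. E \<subseteq> U \<and> open U}. cap U)"
proof (rule antisym)
  show "cap E \<le> (INF U\<in>{U. E \<subseteq> U \<and> open U}. cap U)"
    by (intro INF_greatest) (auto intro: cap_mono)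
  show "(INF U\<in>{U. E \<subseteq> U \<and> open U}. cap U) \<le> cap E" (is "?I \<le> _")
  proof (rule ccontr)
    assume "\<not> ?thesis"
    then have "cap E < ?I" by (simp add: not_le)
    then obtain f where f: "f \<in> borel_measurable M" "\<And>x. 0 \<le> f x"
      and fE: "\<And>x. x \<in> E \<Longrightarrow> 1 \<le> pot f x" and less: "energy f < ?I"
      by (rule cap_lessE) blast
    have le: "?I \<le> ennreal ((1 + 1 / Suc n) powr p) * energy f" for n
    proof -
      define s where "s = 1 + 1 / real (Suc n)"
      have s: "1 < s" by (simp add: s_def)
      define U where "U = {x. 1 < pot (\<lambda>y. s * f y) x}"
      have "E \<subseteq> U"
      proof
        fix x assume "x \<in> E"
        have "1 < ennreal s" using s by simp
        also have "ennreal s * 1 \<le> ennreal s * pot f x"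
          using fE[OF \<open>x \<in> E\<close>] by (rule mult_left_mono) simp
        finally show "x \<in> U" using f s by (simp add: U_def pot_cmult)
      qed
      moreover have "open U"
        unfolding U_def using f s by (intro open_pot_greater) auto
      ultimately have "?I \<le> cap U" by (intro INF_lower) auto
      also have "cap U \<le> energy (\<lambda>y. s * f y)"
        using f s by (intro cap_le_energy) (auto simp: U_def)
      also have "\<dots> = ennreal (s powr p) * energy f"
        using f s by (simp add: powr_mult ennreal_mult nn_integral_cmult)
      finally show ?thesis by (simp add: s_def)
    qed
    obtain r where r: "energy f = ennreal r" "0 \<le> r"
      using less by (cases "energy f") auto
    have "(\<lambda>n. ennreal ((1 + 1 / Suc n) powr p * r)) \<longlonglongrightarrow> ennreal ((1 + 0) powr p * r)"
      by (intro tendsto_intros tendsto_ennrealI LIMSEQ_Suc[OF lim_1_over_n]) auto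
    then have "?I \<le> ennreal ((1 + 0) powr p * r)"
      by (rule LIMSEQ_le_const) (use le r in \<open>auto simp: ennreal_mult\<close>)
    then show False using less r by simp
  qed
qed

lemma ennreal_le_diff: "D + ennreal u \<le> ennreal v \<Longrightarrow> 0 \<le> u \<Longrightarrow> 0 \<le> v \<Longrightarrow> D \<le> ennreal (v - u)"
  by (cases D) (auto simp: top_unique simp flip: ennreal_plus)

text \<open>
  For \<open>n \<le> m\<close> the mean of \<open>f n\<close> and \<open>f m\<close> is still admissible for \<open>E n\<close>, so its energy is at least
  \<open>cap (E n)\<close>, which is close to \<open>l\<close>, while both energies are at most about \<open>l\<close>.  Uniform convexity
  then makes the energy of the difference small.
\<close>

lemma near_minimisers_Cauchy:
  assumes E: "incseq E" and l: "(SUP n. cap (E n)) = ennreal l" "0 \<le> l"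
  obtains f where "\<And>n. f n \<in> borel_measurable M" "\<And>n x. 0 \<le> f n x"
    "\<And>n x. x \<in> E n \<Longrightarrow> 1 \<le> pot (f n) x"
    "\<And>n. energy (f n) \<le> ennreal (l + 1 / Suc n)"
    "\<And>\<delta>. 0 < \<delta> \<Longrightarrow> \<exists>N. \<forall>n\<ge>N. \<forall>m\<ge>n. energy (\<lambda>x. \<bar>f n x - f m x\<bar>) \<le> ennreal \<delta>"
proof -
  have cap_le: "cap (E n) \<le> ennreal l" for n
    using SUP_upper[of n UNIV "\<lambda>n. cap (E n)"] l by simp
  define c where "c n = enn2real (cap (E n))" for n
  have c: "cap (E n) = ennreal (c n)" "0 \<le> c n" for n
    using cap_le[of n] by (auto simp: c_def intro!: ennreal_enn2real[symmetric] elim: le_less_trans)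
  have cl: "c n \<le> l" for n using cap_le[of n] l(2) by (simp add: c)
  have "incseq (\<lambda>n. cap (E n))"
    using E cap_mono by (simp add: incseq_def)
  then have "(\<lambda>n. cap (E n)) \<longlonglongrightarrow> ennreal l"
    using LIMSEQ_SUP l(1) by metis
  then have c_lim: "c \<longlonglongrightarrow> l"
    using l(2) c(2) by (simp add: c(1) tendsto_ennreal_iff)
  have "\<exists>f. f \<in> borel_measurable M \<and> (\<forall>x. 0 \<le> f x) \<and> (\<forall>x\<in>E n. 1 \<le> pot f x) \<and>
      energy f \<le> ennreal (l + 1 / Suc n)" for n
  proof -
    have "cap (E n) < ennreal (l + 1 / Suc n)"
      unfolding c(1) using cl[of n] c(2)[of n] by (intro ennreal_lessI) (auto intro: le_less_trans add_nonneg_pos l)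
    then show ?thesis
      by (rule cap_lessE) (meson less_imp_le)
  qed
  then obtain f where f: "\<And>n. f n \<in> borel_measurable M" "\<And>n x. 0 \<le> f n x"
    "\<And>n x. x \<in> E n \<Longrightarrow> 1 \<le> pot (f n) x" "\<And>n. energy (f n) \<le> ennreal (l + 1 / Suc n)"
    by metis
  have bound: "energy (\<lambda>x. \<bar>f n x - f m x\<bar>) \<le> ennreal ((2 * e + K) * (l + 1 / Suc n) - K * c n)"
    if nm: "n \<le> m" and e: "0 < e" and K: "0 \<le> K" and
      convex: "\<And>a b. 0 \<le> a \<Longrightarrow> 0 \<le> b \<Longrightarrow> \<bar>a - b\<bar> powr p \<le> e * (a powr p + b powr p)
          + K * ((a powr p + b powr p) / 2 - ((a + b) / 2) powr p)" for n m e K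
  proof (rule ennreal_le_diff)
    have mid: "ennreal (c n) \<le> energy (\<lambda>x. (f n x + f m x) / 2)"
      unfolding c(1)[symmetric]
    proof (rule cap_le_energy)
      fix x assume x: "x \<in> E n"
      then have "x \<in> E m" using nm E by (auto simp: incseq_def)
      then show "1 \<le> pot (\<lambda>x. (f n x + f m x) / 2) x"
        using x by (intro pot_midpoint f) 
    qed (use f in auto)
    have "energy (\<lambda>x. \<bar>f n x - f m x\<bar>) + ennreal (K * c n)
        \<le> energy (\<lambda>x. \<bar>f n x - f m x\<bar>) + ennreal K * energy (\<lambda>x. (f n x + f m x) / 2)"
      using mid K c(2) by (auto simp: ennreal_mult intro!: add_left_mono mult_left_mono)
    also have "\<dots> = (\<integral>\<^sup>+x. ennreal (\<bar>f n x - f m x\<bar> powr p) + ennreal K * ennreal (((f n x + f m x) / 2) powr p) \<partial>M)"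
      using f(1) by (simp add: nn_integral_add nn_integral_cmult)
    also have "\<dots> \<le> (\<integral>\<^sup>+x. ennreal (e + K / 2) * (ennreal (f n x powr p) + ennreal (f m x powr p)) \<partial>M)"
    proof (rule nn_integral_mono)
      fix x
      have "\<bar>f n x - f m x\<bar> powr p + K * ((f n x + f m x) / 2) powr p
          \<le> (e + K / 2) * (f n x powr p + f m x powr p)"
        using convex[of "f n x" "f m x"] f(2) by (simp add: algebra_simps add_divide_distrib)
      then show "ennreal (\<bar>f n x - f m x\<bar> powr p) + ennreal K * ennreal (((f n x + f m x) / 2) powr p)
          \<le> ennreal (e + K / 2) * (ennreal (f n x powr p) + ennreal (f m x powr p))"
        using e K by (simp flip: ennreal_mult ennreal_plus)
    qed
    also have "\<dots> = ennreal (e + K / 2) * (energy (f n) + energy (f m))"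
      using f(1) by (simp add: nn_integral_add nn_integral_cmult)
    also have "\<dots> \<le> ennreal (e + K / 2) * (ennreal (l + 1 / Suc n) + ennreal (l + 1 / Suc n))"
    proof (intro mult_left_mono add_mono f(4))
      have "energy (f m) \<le> ennreal (l + 1 / Suc m)" by (rule f(4))
      also have "\<dots> \<le> ennreal (l + 1 / Suc n)"
        using nm by (intro ennreal_leI add_left_mono frac_le) auto
      finally show "energy (f m) \<le> ennreal (l + 1 / Suc n)" .
    qed simp
    also have "\<dots> = ennreal ((2 * e + K) * (l + 1 / Suc n))"
    proof -
      have "ennreal (e + K / 2) * (ennreal q + ennreal q) = ennreal ((2 * e + K) * q)" if "0 \<le> q" for q
        using e K that by (simp add: algebra_simps flip: ennreal_mult ennreal_plus)
      from this[of "l + 1 / Suc n"] show ?thesis using l(2) by (simp del: ennreal_plus)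
    qed
    finally show "energy (\<lambda>x. \<bar>f n x - f m x\<bar>) + ennreal (K * c n) \<le> ennreal ((2 * e + K) * (l + 1 / Suc n))" .
    show "0 \<le> K * c n" using K c(2) by simp
    show "0 \<le> (2 * e + K) * (l + 1 / Suc n)" using e K l(2) by simp
  qed
  show ?thesis
  proof (rule that[OF f])
    fix \<delta> :: real assume \<delta>: "0 < \<delta>"
    \<comment> \<open>As \<open>n\<close> grows, the right-hand side of \<open>bound\<close> tends to \<open>2 * e * l\<close>, whatever \<open>K\<close> is; so \<open>e\<close> is chosen first.\<close>
    define e where "e = \<delta> / (2 * (2 * l + 1))"
    have e: "0 < e" using \<delta> l(2) by (simp add: e_def)
    have el: "2 * e * l < \<delta>" using \<delta> l(2) by (simp add: e_def field_simps add_pos_nonneg)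
    obtain K where K: "0 \<le> K" and convex: "\<And>a b. 0 \<le> a \<Longrightarrow> 0 \<le> b \<Longrightarrow> \<bar>a - b\<bar> powr p \<le> e * (a powr p + b powr p)
          + K * ((a powr p + b powr p) / 2 - ((a + b) / 2) powr p)"
      using powr_uniformly_convex[OF p e] by metis
    have "(\<lambda>n. (2 * e + K) * (l + 1 / Suc n) - K * c n) \<longlonglongrightarrow> (2 * e + K) * (l + 0) - K * l"
      by (intro tendsto_intros c_lim LIMSEQ_Suc[OF lim_1_over_n])
    then have "\<forall>\<^sub>F n in sequentially. (2 * e + K) * (l + 1 / Suc n) - K * c n < \<delta>"
      by (rule order_tendstoD) (use el in \<open>simp add: algebra_simps\<close>)
    then obtain N where N: "\<And>n. N \<le> n \<Longrightarrow> (2 * e + K) * (l + 1 / Suc n) - K * c n < \<delta>"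
      unfolding eventually_sequentially by blast
    have "energy (\<lambda>x. \<bar>f n x - f m x\<bar>) \<le> ennreal \<delta>" if "N \<le> n" "n \<le> m" for n m
      using bound[OF that(2) e K convex] N[OF that(1)] ennreal_leI order_trans less_imp_le by meson
    then show "\<exists>N. \<forall>n\<ge>N. \<forall>m\<ge>n. energy (\<lambda>x. \<bar>f n x - f m x\<bar>) \<le> ennreal \<delta>"
      by blast
  qed
qed

text \<open>
  If consecutive terms of a sequence are very close in \<open>L\<^sup>p\<close>, a single function of hardly larger energy
  dominates them all: every \<open>g k\<close> is at most the sum of \<open>g 0\<close> and of the increments
  \<open>\<bar>g (Suc i) - g i\<bar>\<close>.  The weights \<open>w\<close> put nearly all mass on \<open>g 0\<close>, and \<open>H\<close> is the
  resulting bound for the \<open>p\<close>-th power of the sum.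
\<close>

lemma dominating_function:
  fixes g :: "nat \<Rightarrow> 'a \<Rightarrow> real"
  assumes g: "\<And>k. g k \<in> borel_measurable M" "\<And>k x. 0 \<le> g k x"
    and \<eta>: "0 < \<eta>" "\<eta> < 1" and l: "0 \<le> l"
    and g0: "energy (g 0) \<le> ennreal l"
    and step: "\<And>k. energy (\<lambda>x. \<bar>g (Suc k) x - g k x\<bar>) \<le> ennreal ((\<eta> * (1 / 2) ^ Suc k) powr p)"
  obtains G where "G \<in> borel_measurable M" "\<And>x. 0 \<le> G x" "\<And>k. AE x in M. g k x \<le> G x"
    "energy G \<le> ennreal ((1 - \<eta>) powr (1 - p) * l + \<eta>)"
proof -
  define w where "w k = (case k of 0 \<Rightarrow> 1 - \<eta> | Suc k \<Rightarrow> \<eta> * (1 / 2) ^ Suc k)" for k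
  define a where "a k x = (case k of 0 \<Rightarrow> g 0 x | Suc k \<Rightarrow> \<bar>g (Suc k) x - g k x\<bar>)" for k x
  define b where "b k = (case k of 0 \<Rightarrow> (1 - \<eta>) powr (1 - p) * l | Suc k \<Rightarrow> \<eta> * (1 / 2) ^ Suc k)" for k
  define H where "H x = (\<Sum>k. ennreal (w k powr (1 - p) * a k x powr p))" for x
  define G where "G x = enn2real (H x) powr (1 / p)" for x
  have w_pos: "0 < w k" for k using \<eta> by (simp add: w_def split: nat.split)
  have w_sum: "(\<Sum>i\<le>k. w i) = 1 - \<eta> * (1 / 2) ^ k" for k
    by (induction k) (auto simp: w_def field_simps)
  have a_nonneg: "0 \<le> a k x" for k x using g(2) by (simp add: a_def split: nat.split)
  have a_meas [measurable]: "a k \<in> borel_measurable M" for k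
    using g(1) unfolding a_def by (cases k) auto
  have H_meas [measurable]: "H \<in> borel_measurable M" unfolding H_def by measurable
  have g_le: "g k x \<le> (\<Sum>i\<le>k. a i x)" for k x
  proof (induction k)
    case (Suc k)
    have "a (Suc k) x = \<bar>g (Suc k) x - g k x\<bar>" by (simp add: a_def)
    then show ?case using Suc by simp
  qed (simp add: a_def)
  have integral_le: "(\<integral>\<^sup>+x. ennreal (w k powr (1 - p) * a k x powr p) \<partial>M) \<le> ennreal (b k)" for k
  proof -
    have "(\<integral>\<^sup>+x. ennreal (w k powr (1 - p) * a k x powr p) \<partial>M) = ennreal (w k powr (1 - p)) * energy (a k)"
      by (simp add: ennreal_mult nn_integral_cmult)
    also have "\<dots> \<le> ennreal (b k)"
    proof (cases k)
      case 0
      have "ennreal ((1 - \<eta>) powr (1 - p)) * energy (g 0) \<le> ennreal ((1 - \<eta>) powr (1 - p)) * ennreal l"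
        using g0 by (rule mult_left_mono) simp
      then show ?thesis using l by (simp add: 0 w_def a_def b_def ennreal_mult)
    next
      case (Suc j)
      define d where "d = \<eta> * (1 / 2) ^ Suc j"
      have d: "0 < d" using \<eta> by (simp add: d_def)
      have "ennreal (d powr (1 - p)) * energy (a k) \<le> ennreal (d powr (1 - p)) * ennreal (d powr p)"
        using step[of j] unfolding d_def Suc a_def by (intro mult_left_mono) simp_all
      also have "\<dots> = ennreal d"
        using d by (simp flip: ennreal_mult powr_add)
      finally show ?thesis by (simp add: Suc w_def b_def d_def)
    qed
    finally show ?thesis .
  qed
  have "b sums (b 0 + \<eta>)"
  proof -
    have "(\<lambda>k. \<eta> * (1 / 2) ^ Suc k) sums (\<eta> * 1)"
      by (rule sums_mult[OF power_half_series])
    then have "(\<lambda>k. b (Suc k)) sums \<eta>" by (simp add: b_def)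
    then show ?thesis by (simp add: sums_Suc_iff add.commute)
  qed
  moreover have "0 \<le> b k" for k using \<eta> l by (simp add: b_def split: nat.split)
  ultimately have b_sum: "(\<Sum>k. ennreal (b k)) = ennreal (b 0 + \<eta>)"
    by (intro suminf_ennreal_eq)
  have "(\<integral>\<^sup>+x. H x \<partial>M) = (\<Sum>k. \<integral>\<^sup>+x. ennreal (w k powr (1 - p) * a k x powr p) \<partial>M)"
    unfolding H_def by (rule nn_integral_suminf) measurable
  also have "\<dots> \<le> (\<Sum>k. ennreal (b k))"
    by (intro suminf_le integral_le) auto
  finally have H_le: "(\<integral>\<^sup>+x. H x \<partial>M) \<le> ennreal (b 0 + \<eta>)" using b_sum by simp
  have H_fin: "AE x in M. H x \<noteq> \<infinity>"
    using H_le by (intro nn_integral_PInf_AE) (auto simp: top_unique)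
  show ?thesis
  proof (rule that[of G])
    show "G \<in> borel_measurable M" unfolding G_def by measurable
    show "0 \<le> G x" for x by (simp add: G_def)
    show "AE x in M. g k x \<le> G x" for k
      using H_fin
    proof eventually_elim
      case (elim x)
      have "(\<Sum>i\<le>k. a i x) powr p \<le> (\<Sum>i\<le>k. w i powr (1 - p) * a i x powr p)"
        by (rule powr_sum_le_weighted[OF p]) (use a_nonneg w_pos w_sum \<eta> in auto)
      also have "\<dots> \<le> enn2real (H x)"
      proof -
        have "ennreal (\<Sum>i\<le>k. w i powr (1 - p) * a i x powr p) = (\<Sum>i\<le>k. ennreal (w i powr (1 - p) * a i x powr p))"
          by (simp add: sum_ennreal)
        also have "\<dots> \<le> H x"
          unfolding H_def by (rule sum_le_suminf) auto
        also have "\<dots> = ennreal (enn2real (H x))"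
          using elim by (simp add: less_top)
        finally show ?thesis by simp
      qed
      finally have "((\<Sum>i\<le>k. a i x) powr p) powr (1 / p) \<le> G x"
        unfolding G_def using p by (intro powr_mono2) auto
      then have "(\<Sum>i\<le>k. a i x) \<le> G x"
        using p a_nonneg by (simp add: powr_powr sum_nonneg)
      then show ?case using g_le[where k = k and x = x] by simp
    qed
    have "energy G = (\<integral>\<^sup>+x. ennreal (enn2real (H x)) \<partial>M)"
      using p by (simp add: G_def powr_powr)
    also have "\<dots> \<le> (\<integral>\<^sup>+x. H x \<partial>M)"
      by (intro nn_integral_mono) (simp add: ennreal_enn2real_if)
    also note H_le
    finally show "energy G \<le> ennreal ((1 - \<eta>) powr (1 - p) * l + \<eta>)" by (simp add: b_def)
  qed
qed

text \<open>
  Instead of passing to a limit of near minimisers, which is admissible only up to a set of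
  capacity zero, take a function that dominates a rapidly converging subsequence: it is admissible for
  every \<open>E n\<close>, and its energy is as close to the supremum as desired.
\<close>

lemma cap_incseq:
  assumes E: "incseq E"
  shows "cap (\<Union>n. E n) = (SUP n. cap (E n))"
proof (rule antisym)
  show "(SUP n. cap (E n)) \<le> cap (\<Union>n. E n)"
    by (intro SUP_least cap_mono) auto
  show "cap (\<Union>n. E n) \<le> (SUP n. cap (E n))"
  proof (cases "SUP n. cap (E n)")
    case (real l)
    obtain f where f: "\<And>n. f n \<in> borel_measurable M" "\<And>n x. 0 \<le> f n x"
      and fE: "\<And>n x. x \<in> E n \<Longrightarrow> 1 \<le> pot (f n) x"
      and energy: "\<And>n. energy (f n) \<le> ennreal (l + 1 / Suc n)"
      and Cauchy: "\<And>\<delta>. 0 < \<delta> \<Longrightarrow> \<exists>N. \<forall>n\<ge>N. \<forall>m\<ge>n. energy (\<lambda>x. \<bar>f n x - f m x\<bar>) \<le> ennreal \<delta>"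
      by (rule near_minimisers_Cauchy[OF E real(2,1)]) blast
    have le: "cap (\<Union>n. E n) \<le> ennreal ((1 - \<eta>) powr (1 - p) * (l + \<eta>) + \<eta>)" if \<eta>: "0 < \<eta>" "\<eta> < 1" for \<eta>
    proof -
      have "\<forall>k. \<exists>N. \<forall>n\<ge>N. \<forall>m\<ge>n. energy (\<lambda>x. \<bar>f n x - f m x\<bar>) \<le> ennreal ((\<eta> * (1 / 2) ^ Suc k) powr p)"
        using \<eta> by (intro allI Cauchy) simp
      then obtain N where N: "\<And>k n m. N k \<le> n \<Longrightarrow> n \<le> m \<Longrightarrow>
          energy (\<lambda>x. \<bar>f n x - f m x\<bar>) \<le> ennreal ((\<eta> * (1 / 2) ^ Suc k) powr p)"
        by metis
      obtain N0 where N0: "1 / Suc N0 < \<eta>" using \<eta> nat_approx_posE by blast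
      have "\<exists>r. \<forall>k. max N0 (N k) \<le> r k \<and> r k < r (Suc k)"
      proof (rule dependent_nat_choice)
        show "\<exists>y. max N0 (N 0) \<le> y" by (rule exI[of _ "max N0 (N 0)"]) simp
        show "\<exists>y. max N0 (N (Suc k)) \<le> y \<and> x < y" for x k
          by (intro exI[of _ "Suc (max x (max N0 (N (Suc k))))"]) auto
      qed
      then obtain r where r: "\<And>k. N0 \<le> r k" "\<And>k. N k \<le> r k" "\<And>k. r k < r (Suc k)" by auto
      have r_mono: "strict_mono r" using r(3) by (rule strict_monoI_Suc)
      have first: "energy (f (r 0)) \<le> ennreal (l + \<eta>)"
      proof -
        have "1 / Suc (r 0) \<le> 1 / Suc N0" using r(1)[of 0] by (intro frac_le) auto
        then have "l + 1 / Suc (r 0) \<le> l + \<eta>" using N0 by simp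
        then show ?thesis using energy[of "r 0"] ennreal_leI order_trans by blast
      qed
      have step: "energy (\<lambda>x. \<bar>f (r (Suc k)) x - f (r k) x\<bar>) \<le> ennreal ((\<eta> * (1 / 2) ^ Suc k) powr p)" for k
        using N[OF r(2)[of k] less_imp_le[OF r(3)[of k]]] by (simp add: abs_minus_commute)
      have "0 \<le> l + \<eta>" using real(1) \<eta> by simp
      then obtain G where G: "G \<in> borel_measurable M" "\<And>x. 0 \<le> G x"
        "\<And>k. AE x in M. f (r k) x \<le> G x" "energy G \<le> ennreal ((1 - \<eta>) powr (1 - p) * (l + \<eta>) + \<eta>)"
        using dominating_function[where g = "\<lambda>k. f (r k)", OF f(1) f(2) \<eta> _ first step] by blast
      have "cap (\<Union>n. E n) \<le> energy G"
      proof (rule cap_le_energy[OF G(1,2)])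
        fix x assume "x \<in> (\<Union>n. E n)"
        then obtain n where "x \<in> E n" by blast
        then have "x \<in> E (r n)"
          using E seq_suble[OF r_mono, of n] by (auto simp: incseq_def)
        then have "1 \<le> pot (f (r n)) x" by (rule fE)
        also have "\<dots> \<le> pot G x" by (rule pot_mono_AE[OF G(3)])
        finally show "1 \<le> pot G x" .
      qed
      then show ?thesis using G(4) by simp
    qed
    have "(\<lambda>n. ennreal ((1 - 1 / Suc (Suc n)) powr (1 - p) * (l + 1 / Suc (Suc n)) + 1 / Suc (Suc n)))
        \<longlonglongrightarrow> ennreal ((1 - 0) powr (1 - p) * (l + 0) + 0)"
      by (intro tendsto_intros tendsto_ennrealI LIMSEQ_Suc[OF LIMSEQ_Suc[OF lim_1_over_n]]) auto
    then have "cap (\<Union>n. E n) \<le> ennreal ((1 - 0) powr (1 - p) * (l + 0) + 0)"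
      by (rule LIMSEQ_le_const) (use le in auto)
    then show ?thesis using real by simp
  next
    case top
    show ?thesis unfolding top by simp
  qed
qed

section \<open>Capacitability\<close>

lemma capacitable_image:
  assumes "\<And>i. incseq (A i)" "\<And>i. Y \<subseteq> (\<Union>j::nat. A (i::nat) j)"
    and "\<And>m y. (\<And>n. y n \<in> Y) \<Longrightarrow> (\<And>i. \<forall>\<^sub>F n in sequentially. y n \<in> A i (m i)) \<Longrightarrow>
        \<exists>l\<in>g ` Y. \<exists>r. strict_mono r \<and> (g \<circ> y \<circ> r) \<longlonglongrightarrow> l"
  shows "capacitable cap (g ` Y)"
proof -
  have "cap (g ` Y) \<le> (SUP K\<in>{K. K \<subseteq> g ` Y \<and> compact K}. cap K)"
  proof (rule dense_le)
    fix t assume t: "t < cap (g ` Y)"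
    obtain K where "compact K" "K \<subseteq> g ` Y" "t \<le> cap K"
      by (rule capacity_compact_approximation[OF cap_mono cap_incseq cap_outer_regular assms t])
    then show "t \<le> (SUP K\<in>{K. K \<subseteq> g ` Y \<and> compact K}. cap K)"
      by (intro SUP_upper2) auto
  qed
  moreover have "(SUP K\<in>{K. K \<subseteq> g ` Y \<and> compact K}. cap K) \<le> cap (g ` Y)"
    by (intro SUP_least) (auto intro: cap_mono)
  ultimately show ?thesis
    unfolding capacitable_def using cap_outer_regular[of "g ` Y"] by simp
qed

lemma analytic_capacitable:
  assumes "analytic_set TYPE('b) E"
  shows "capacitable cap E"
proof (cases "E = {}")
  case True
  then show ?thesis
    using cap_outer_regular[of E] by (simp add: capacitable_def)
next
  case False
  then obtain Y :: "'b topology" and g where Y: "polish_topology Y" and g: "continuous_map Y euclidean g"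
    and E: "E = g ` topspace Y"
    using assms unfolding analytic_set_def by blast
  have ne: "topspace Y \<noteq> {}" using E False by blast
  obtain A :: "nat \<Rightarrow> nat \<Rightarrow> 'b set" where A: "\<And>i. incseq (A i)" "\<And>i. topspace Y \<subseteq> (\<Union>j. A i j)"
    and lim: "\<And>m y. (\<And>n. y n \<in> topspace Y) \<Longrightarrow> (\<And>i. \<forall>\<^sub>F n in sequentially. y n \<in> A i (m i)) \<Longrightarrow>
      \<exists>l r. strict_mono (r::nat\<Rightarrow>nat) \<and> limitin Y (y \<circ> r) l sequentially"
    by (rule polish_ball_covers[OF Y ne]) blast
  show ?thesis
    unfolding E
  proof (rule capacitable_image[OF A])
    fix m y
    assume "\<And>n. y n \<in> topspace Y" "\<And>i. \<forall>\<^sub>F n in sequentially. y n \<in> A i (m i)"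
    then obtain l r where r: "strict_mono r" "limitin Y (y \<circ> r) l sequentially"
      using lim[of y m] by blast
    then have "limitin euclidean (g \<circ> (y \<circ> r)) (g l) sequentially"
      by (intro continuous_map_limit[OF g])
    moreover have "l \<in> topspace Y" using r(2) by (rule limitin_topspace)
    ultimately show "\<exists>l\<in>g ` topspace Y. \<exists>r. strict_mono r \<and> (g \<circ> y \<circ> r) \<longlonglongrightarrow> l"
      using r(1) by (auto simp: comp_assoc)
  qed
qed

lemma borel_capacitable:
  assumes lc: "locally_compact_space (euclidean :: 'a topology)" and E: "E \<in> sets borel"
  shows "capacitable cap E"
proof -
  have "0 < emeasure M (ball x r) \<and> emeasure M (ball x r) < \<infinity>" if "0 < r" for x r
    using vol_pos[OF that] by (simp add: emeasure_ball)
  then obtain K :: "nat \<Rightarrow> 'a set" where "\<And>n. compact (K n)" "(\<Union>n. K n) = UNIV"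
    using locally_compact_sigma_compact[OF lc borel_M] by metis
  then have "compactly_resolvable E"
    using compactly_resolvable_borel E by blast
  then obtain A :: "nat \<Rightarrow> nat \<Rightarrow> 'a set" where A: "\<And>i. incseq (A i)" "\<And>i. E \<subseteq> (\<Union>j. A i j)"
    and lim: "\<And>m x. (\<forall>n. x n \<in> E) \<Longrightarrow> (\<forall>i. \<forall>\<^sub>F n in sequentially. x n \<in> A i (m i)) \<Longrightarrow>
          \<exists>l\<in>E. \<exists>r. strict_mono r \<and> (x \<circ> r) \<longlonglongrightarrow> l"
    unfolding compactly_resolvable_def by metis
  have "capacitable cap ((\<lambda>x. x) ` E)"
  proof (rule capacitable_image[OF A])
    fix m y
    assume "\<And>n. y n \<in> E" "\<And>i. \<forall>\<^sub>F n in sequentially. y n \<in> A i (m i)"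
    then show "\<exists>l\<in>(\<lambda>x. x) ` E. \<exists>r. strict_mono r \<and> ((\<lambda>x. x) \<circ> y \<circ> r) \<longlonglongrightarrow> l"
      using lim[of y m] by (simp add: o_def)
  qed
  then show ?thesis by simp
qed
end

theorem theorem3p15:
  fixes \<mu> :: "'a::metric_space set \<Rightarrow> ennreal" and p \<gamma> :: real
  assumes "locally_compact_space (euclidean :: 'a topology)"
    and "outer_measure_space (Pow UNIV) \<mu>"
    and "borel_regular \<mu>"
    and "doubling \<mu>"
    and "\<And>x r. 0 < r \<Longrightarrow> 0 < \<mu> (ball x r) \<and> \<mu> (ball x r) < \<infinity>"
    and "\<And>x r. 0 < r \<Longrightarrow> \<mu> (sphere x r) = 0"
    and "\<And>x. \<mu> {x} = 0"
    and "1 < p"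
    and "0 < \<gamma>" and "\<gamma> < 1"
  shows "(\<forall>E. analytic_set TYPE('b) E \<longrightarrow> capacitable (riesz_capacity \<mu> \<gamma> p) E) \<and>
         (\<forall>E\<in>sets borel. capacitable (riesz_capacity \<mu> \<gamma> p) E)"
proof -
  interpret riesz_setting \<mu> p \<gamma>
    by unfold_locales fact+
  show ?thesis
    using analytic_capacitable borel_capacitable[OF assms(1)] by blast
qed

end
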